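(* Let $N\ge1$, let $A:\mathbb{R}\to\mathbb{R}^{N\times N}$ be locally integrable, let $\mu$ be a growth rate, and consider the family of translated equations $\dot x=A_\tau(t)x$, $\tau\in\mathbb{R}$, where $A_\tau(t)=A(t+\tau)$. There exists $m\in\{1,\dots,N\}$ such that $$\Sigma_{\mathrm{N}\mu\mathrm{D}}(A)=\Sigma_{\mathrm{N}\mu\mathrm{D}}(A_{\tau\in\mathbb{R}})=\bigcup_{i=1}^m[a_i,b_i]$$ for some $a_i,b_i\in\overline{\mathbb{R}}$ with $a_i\le b_i$ for all $i$ and $b_i<a_{i+1}$ for $1\le i<m$. Moreover, the family of equations has nonuniform $\mu$-bounded growth if and only if $\Sigma_{\mathrm{N}\mu\mathrm{D}}(A_{\tau\in\mathbb{R}})$ is bounded.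
   Context: A growth rate is a strictly increasing differentiable function $\mu:\mathbb{R}\to\mathbb{R}^+$ with $\mu(0)=1$, $\lim_{t\to+\infty}\mu(t)=+\infty$, $\lim_{t\to-\infty}\mu(t)=0$; its $\tau$-translation is the growth rate $\mu_\tau(t)=\mu(t+\tau)/\mu(\tau)$. $\overline{\mathbb{R}}=\mathbb{R}\cup\{\pm\infty\}$ carries its usual topology and order, and intervals $[a_i,b_i]$ are taken in $\overline{\mathbb{R}}$; "bounded" means being a bounded subset of $\mathbb{R}$. Single equation: $\dot x=B(t)x$ ($B$ locally integrable, evolution operator $\Phi$) has nonuniform $\mu$-dichotomy (N$\mu$D) with projector $\mathrm{P}$ if $\mathrm{P}(s)$, $s\in\mathbb{R}$, are projections with $\mathrm{P}(t)\Phi(t,s)=\Phi(t,s)\mathrm{P}(s)$ for all $t,s$, and there are $K\ge1$, $\alpha<0$, $\beta>0$, $\theta,\nu\ge0$ with $\alpha+\theta<0$, $\beta-\nu>0$ such that $\|\Phi(t,s)\mathrm{P}(s)\|\le K(\mu(t)/\mu(s))^\alpha\mu(s)^{\mathrm{sgn}(s)\theta}$ for $t\ge s$ and $\|\Phi(t,s)[\mathrm{Id}-\mathrm{P}(s)]\|\le K(\mu(t)/\mu(s))^\beta\mu(s)^{\mathrm{sgn}(s)\nu}$ for $t\le s$. Family: let $\Phi_\tau(t,s)=\Phi(t+\tau,s+\tau)$ be the evolution operator of the translated equation $\dot x=B(t+\tau)x$. The family of translated equations (over $\tau\in\mathbb{R}$) has N$\mu$D with projector $\mathrm{P}$ if $\mathrm{P}$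 is an invariant projector for $\dot x=B(t)x$ (that is, $\mathrm{P}(s)$, $s\in\mathbb{R}$, are projections with $\mathrm{P}(t)\Phi(t,s)=\Phi(t,s)\mathrm{P}(s)$ for all $t,s\in\mathbb{R}$) and there are a continuous map $\tau\mapsto K_\tau\in[1,+\infty)$ and constants $\alpha<0$, $\beta>0$, $\theta,\nu\ge0$ with $\alpha+\theta<0$, $\beta-\nu>0$ such that for every $\tau\in\mathbb{R}$, with $\mathrm{P}_\tau(s)=\mathrm{P}(s+\tau)$: $\|\Phi_\tau(t,s)\mathrm{P}_\tau(s)\|\le K_\tau(\mu_\tau(t)/\mu_\tau(s))^\alpha\mu_\tau(s)^{\mathrm{sgn}(s)\theta}$ for $t\ge s$ and $\|\Phi_\tau(t,s)[\mathrm{Id}-\mathrm{P}_\tau(s)]\|\le K_\tau(\mu_\tau(t)/\mu_\tau(s))^\beta\mu_\tau(s)^{\mathrm{sgn}(s)\nu}$ for $t\le s$. The family has nonuniform $\mu$-bounded growth if there are a continuous map $\tau\mapsto L_\tau\in[1,+\infty)$ and $a>0$, $\epsilon\ge0$ with $\|\Phi_\tau(t,s)\|\le L_\tau(\mu_\tau(t)/\mu_\tau(s))^{\mathrm{sgn}(t-s)a}\mu_\tau(s)^{\mathrm{sgn}(s)\epsilon}$ for all $t,s,\tau\in\mathbb{R}$. Spectra: for $\gamma\in\mathbb{R}$, the shifted equation is $\dot y=\big(A(t)-\gamma\frac{\dot\mu(t)}{\mu(t)}\mathrm{Id}\big)y$, and its translations are $\dot y=\big(A_\tau(t)-\gamma\frac{\dot\mu_\tau(t)}{\mu_\tau(t)}\mathrm{Id}\big)y$,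 $\tau\in\mathbb{R}$. By convention the shifted equation (resp. shifted family) has N$\mu$D for $\gamma=+\infty$ (resp. $\gamma=-\infty$) if for some real $\widehat\gamma$ the shifted equation (resp. family) with $\gamma=\widehat\gamma$ has N$\mu$D with $\mathrm{P}\equiv\mathrm{Id}$ (resp. $\mathrm{P}\equiv0$). $\Sigma_{\mathrm{N}\mu\mathrm{D}}(A)$ is the set of $\gamma\in\overline{\mathbb{R}}$ for which the shifted equation does not have N$\mu$D; $\Sigma_{\mathrm{N}\mu\mathrm{D}}(A_{\tau\in\mathbb{R}})$ is the set of $\gamma\in\overline{\mathbb{R}}$ for which the shifted family does not have N$\mu$D. *)

theory Defs
  imports "HOL-Analysis.Analysis"
begin

section \<open>Growth rates\<close>

definition growth_rate :: "(real \<Rightarrow> real) \<Rightarrow> bool" where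
  "growth_rate \<mu> \<longleftrightarrow>
     (\<forall>t. \<mu> t > 0) \<and> strict_mono \<mu> \<and> (\<forall>t. \<mu> differentiable (at t)) \<and> \<mu> 0 = 1 \<and>
     filterlim \<mu> at_top at_top \<and> (\<mu> \<longlongrightarrow> 0) at_bot"

definition translate_rate :: "(real \<Rightarrow> real) \<Rightarrow> real \<Rightarrow> real \<Rightarrow> real" where
  "translate_rate \<mu> \<tau> t = \<mu> (t + \<tau>) / \<mu> \<tau>"

section \<open>Linear equations with locally integrable coefficients\<close>

definition locally_integrable :: "(real \<Rightarrow> real^'n^'n) \<Rightarrow> bool" where
  "locally_integrable B \<longleftrightarrow> (\<forall>a b. B absolutely_integrable_on {a..b})"

text \<open>
  Solutions are understood in the sense of Caratheodory: \<open>\<Phi>(\<cdot>, s)\<close> is continuous and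
  \<open>\<Phi>(t, s) = Id + \<integral>\<^sub>s\<^sup>t B(r) \<Phi>(r, s) dr\<close> for all \<open>t\<close>, the two orientations of the integral
  being written out separately. For locally integrable \<open>B\<close> there is exactly one such \<open>\<Phi>\<close>.
\<close>

definition is_evolution_operator ::
    "(real \<Rightarrow> real^'n^'n) \<Rightarrow> (real \<Rightarrow> real \<Rightarrow> real^'n^'n) \<Rightarrow> bool" where
  "is_evolution_operator B \<Phi> \<longleftrightarrow>
     (\<forall>s. continuous_on UNIV (\<lambda>t. \<Phi> t s)) \<and>
     (\<forall>s t. s \<le> t \<longrightarrow> ((\<lambda>r. B r ** \<Phi> r s) has_integral (\<Phi> t s - mat 1)) {s..t}) \<and>
     (\<forall>s t. t \<le> s \<longrightarrow> ((\<lambda>r. B r ** \<Phi> r s) has_integral (mat 1 - \<Phi> t s)) {t..s})"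

definition evolution_operator :: "(real \<Rightarrow> real^'n^'n) \<Rightarrow> real \<Rightarrow> real \<Rightarrow> real^'n^'n" where
  "evolution_operator B = (THE \<Phi>. is_evolution_operator B \<Phi>)"

definition translated_evolution ::
    "(real \<Rightarrow> real^'n^'n) \<Rightarrow> real \<Rightarrow> real \<Rightarrow> real \<Rightarrow> real^'n^'n" where
  "translated_evolution B \<tau> t s = evolution_operator B (t + \<tau>) (s + \<tau>)"

text \<open>This is the evolution operator of the translated equation:\<close>

lemma is_evolution_operator_translate:
  assumes "is_evolution_operator B \<Phi>"
  shows "is_evolution_operator (\<lambda>t. B (t + \<tau>)) (\<lambda>t s. \<Phi> (t + \<tau>) (s + \<tau>))"
proof -
  have shift: "((\<lambda>r. f (r + \<tau>)) has_integral I) {a..b}"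
    if "(f has_integral I) {a + \<tau>..b + \<tau>}" for f :: "real \<Rightarrow> real^'n^'n" and I a b
    using has_integral_affinity[of f I "a + \<tau>" "b + \<tau>" 1 \<tau>] that by simp
  have "continuous_on UNIV (\<lambda>t. \<Phi> (t + \<tau>) (s + \<tau>))" for s
    using assms unfolding is_evolution_operator_def
    by (intro continuous_on_compose2[of UNIV "\<lambda>t. \<Phi> t (s + \<tau>)" UNIV "\<lambda>t. t + \<tau>"])
       (auto intro!: continuous_intros)
  then show ?thesis
    using assms unfolding is_evolution_operator_def
    by (auto intro!: shift[of "\<lambda>r. B r ** \<Phi> r (_ + \<tau>)"])
qed

definition mat_norm :: "real^'n^'n \<Rightarrow> real" where
  "mat_norm M = onorm (\<lambda>x. M *v x)"

definition invariant_projector :: "(real \<Rightarrow> real^'n^'n) \<Rightarrow> (real \<Rightarrow> real^'n^'n) \<Rightarrow> bool" where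
  "invariant_projector B P \<longleftrightarrow>
     (\<forall>s. P s ** P s = P s) \<and>
     (\<forall>t s. P t ** evolution_operator B t s = evolution_operator B t s ** P s)"

section \<open>Nonuniform dichotomy and nonuniform bounded growth\<close>

definition nmu_dichotomy ::
    "(real \<Rightarrow> real) \<Rightarrow> (real \<Rightarrow> real^'n^'n) \<Rightarrow> (real \<Rightarrow> real^'n^'n) \<Rightarrow> bool" where
  "nmu_dichotomy \<mu> B P \<longleftrightarrow> invariant_projector B P \<and>
     (\<exists>K \<alpha> \<beta> \<theta> \<nu> :: real. K \<ge> 1 \<and> \<alpha> < 0 \<and> \<beta> > 0 \<and> \<theta> \<ge> 0 \<and> \<nu> \<ge> 0 \<and> \<alpha> + \<theta> < 0 \<and> \<beta> - \<nu> > 0 \<and>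
        (\<forall>t s. t \<ge> s \<longrightarrow> mat_norm (evolution_operator B t s ** P s)
            \<le> K * (\<mu> t / \<mu> s) powr \<alpha> * \<mu> s powr (sgn s * \<theta>)) \<and>
        (\<forall>t s. t \<le> s \<longrightarrow> mat_norm (evolution_operator B t s ** (mat 1 - P s))
            \<le> K * (\<mu> t / \<mu> s) powr \<beta> * \<mu> s powr (sgn s * \<nu>)))"

definition nmu_dichotomy_family ::
    "(real \<Rightarrow> real) \<Rightarrow> (real \<Rightarrow> real^'n^'n) \<Rightarrow> (real \<Rightarrow> real^'n^'n) \<Rightarrow> bool" where
  "nmu_dichotomy_family \<mu> B P \<longleftrightarrow> invariant_projector B P \<and>
     (\<exists>(K :: real \<Rightarrow> real) (\<alpha> :: real) \<beta> \<theta> \<nu>.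
        continuous_on UNIV K \<and> (\<forall>\<tau>. K \<tau> \<ge> 1) \<and>
        \<alpha> < 0 \<and> \<beta> > 0 \<and> \<theta> \<ge> 0 \<and> \<nu> \<ge> 0 \<and> \<alpha> + \<theta> < 0 \<and> \<beta> - \<nu> > 0 \<and>
        (\<forall>\<tau> t s. t \<ge> s \<longrightarrow> mat_norm (translated_evolution B \<tau> t s ** P (s + \<tau>))
            \<le> K \<tau> * (translate_rate \<mu> \<tau> t / translate_rate \<mu> \<tau> s) powr \<alpha>
                  * translate_rate \<mu> \<tau> s powr (sgn s * \<theta>)) \<and>
        (\<forall>\<tau> t s. t \<le> s \<longrightarrow> mat_norm (translated_evolution B \<tau> t s ** (mat 1 - P (s + \<tau>)))
            \<le> K \<tau> * (translate_rate \<mu> \<tau> t / translate_rate \<mu> \<tau> s) powr \<beta>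
                  * translate_rate \<mu> \<tau> s powr (sgn s * \<nu>)))"

definition nmu_bounded_growth_family ::
    "(real \<Rightarrow> real) \<Rightarrow> (real \<Rightarrow> real^'n^'n) \<Rightarrow> bool" where
  "nmu_bounded_growth_family \<mu> B \<longleftrightarrow>
     (\<exists>(L :: real \<Rightarrow> real) a \<epsilon>. continuous_on UNIV L \<and> (\<forall>\<tau>. L \<tau> \<ge> 1) \<and> a > 0 \<and> \<epsilon> \<ge> 0 \<and>
        (\<forall>\<tau> t s. mat_norm (translated_evolution B \<tau> t s)
            \<le> L \<tau> * (translate_rate \<mu> \<tau> t / translate_rate \<mu> \<tau> s) powr (sgn (t - s) * a)
                  * translate_rate \<mu> \<tau> s powr (sgn s * \<epsilon>)))"

section \<open>Spectra\<close>

definition shifted ::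
    "(real \<Rightarrow> real) \<Rightarrow> (real \<Rightarrow> real^'n^'n) \<Rightarrow> real \<Rightarrow> real \<Rightarrow> real^'n^'n" where
  "shifted \<mu> A \<gamma> t = A t - (\<gamma> * (deriv \<mu> t / \<mu> t)) *\<^sub>R mat 1"

text \<open>
  The shift of the translated equation (with respect to the translated growth rate) is the
  translation of the shifted equation, so the shifted family is the family of translations
  of \<open>shifted \<mu> A \<gamma>\<close>.
\<close>

lemma shifted_translate:
  assumes "growth_rate \<mu>"
  shows "shifted (translate_rate \<mu> \<tau>) (\<lambda>t. A (t + \<tau>)) \<gamma> t = shifted \<mu> A \<gamma> (t + \<tau>)"
proof -
  have pos: "\<mu> \<tau> > 0" and "\<mu> differentiable (at (t + \<tau>))"
    using assms by (auto simp: growth_rate_def)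
  then have "(\<mu> has_field_derivative deriv \<mu> (t + \<tau>)) (at (t + \<tau>))"
    using DERIV_deriv_iff_real_differentiable by blast
  then have "((\<lambda>t. \<mu> (t + \<tau>) / \<mu> \<tau>) has_field_derivative deriv \<mu> (t + \<tau>) / \<mu> \<tau>) (at t)"
    by (intro DERIV_cdivide) (simp add: DERIV_shift)
  then have "deriv (translate_rate \<mu> \<tau>) t = deriv \<mu> (t + \<tau>) / \<mu> \<tau>"
    unfolding translate_rate_def[abs_def] by (rule DERIV_imp_deriv)
  with pos show ?thesis
    by (simp add: shifted_def translate_rate_def)
qed

definition shifted_has_dichotomy ::
    "(real \<Rightarrow> real) \<Rightarrow> (real \<Rightarrow> real^'n^'n) \<Rightarrow> ereal \<Rightarrow> bool" where
  "shifted_has_dichotomy \<mu> A \<gamma> \<longleftrightarrow>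
     (case \<gamma> of
        ereal g \<Rightarrow> (\<exists>P. nmu_dichotomy \<mu> (shifted \<mu> A g) P)
      | PInfty \<Rightarrow> (\<exists>g. nmu_dichotomy \<mu> (shifted \<mu> A g) (\<lambda>_. mat 1))
      | MInfty \<Rightarrow> (\<exists>g. nmu_dichotomy \<mu> (shifted \<mu> A g) (\<lambda>_. 0)))"

definition shifted_family_has_dichotomy ::
    "(real \<Rightarrow> real) \<Rightarrow> (real \<Rightarrow> real^'n^'n) \<Rightarrow> ereal \<Rightarrow> bool" where
  "shifted_family_has_dichotomy \<mu> A \<gamma> \<longleftrightarrow>
     (case \<gamma> of
        ereal g \<Rightarrow> (\<exists>P. nmu_dichotomy_family \<mu> (shifted \<mu> A g) P)
      | PInfty \<Rightarrow> (\<exists>g. nmu_dichotomy_family \<mu> (shifted \<mu> A g) (\<lambda>_. mat 1))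
      | MInfty \<Rightarrow> (\<exists>g. nmu_dichotomy_family \<mu> (shifted \<mu> A g) (\<lambda>_. 0)))"

definition nmu_spectrum :: "(real \<Rightarrow> real) \<Rightarrow> (real \<Rightarrow> real^'n^'n) \<Rightarrow> ereal set" where
  "nmu_spectrum \<mu> A = {\<gamma>. \<not> shifted_has_dichotomy \<mu> A \<gamma>}"

definition nmu_spectrum_family :: "(real \<Rightarrow> real) \<Rightarrow> (real \<Rightarrow> real^'n^'n) \<Rightarrow> ereal set" where
  "nmu_spectrum_family \<mu> A = {\<gamma>. \<not> shifted_family_has_dichotomy \<mu> A \<gamma>}"

definition bounded_subset_of_reals :: "ereal set \<Rightarrow> bool" where
  "bounded_subset_of_reals S \<longleftrightarrow> (\<exists>T :: real set. bounded T \<and> S = ereal ` T)"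

end

theory Submission imports Defs begin

text \<open>
  Put \<open>h = ln \<circ> \<mu>\<close>. The evolution operator of the shifted equation is
  \<open>exp (-\<gamma> (h t - h s)) \<Phi>(t, s)\<close>, and the dichotomy bounds become exponential in \<open>h t - h s\<close> with
  a factor \<open>exp (\<theta> \<bar>h s\<bar>)\<close>. The triangle inequality \<open>\<bar>h s\<bar> \<le> \<bar>h s - h \<tau>\<bar> + \<bar>h \<tau>\<bar>\<close> lets the
  translated family inherit a dichotomy with \<open>K\<^sub>\<tau> = K exp (max \<theta> \<nu> \<bar>h \<tau>\<bar>)\<close>, so the two spectra agree.

  If the equation shifted by \<open>\<gamma>\<close> has a dichotomy, the range of its projector at time \<open>0\<close> is the space
  of initial values with \<open>\<Phi>(t, 0)\<xi> = O(exp (\<gamma> h t))\<close> on \<open>t \<ge> 0\<close>, and the kernel is the analogous space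
  on \<open>t \<le> 0\<close>; here \<open>\<alpha> + \<theta> < 0 < \<beta> - \<nu>\<close> enters. The rank of the projector is therefore monotone in
  \<open>\<gamma>\<close>, locally constant on the resolvent set, and two resolvent points of equal rank share their
  projector, so that everything between them belongs to the resolvent set. Ranks \<open>0\<close> and \<open>N\<close>
  correspond to \<open>-\<infinity>\<close> and \<open>+\<infinity>\<close>, which leaves at least one and at most \<open>N\<close> gaps. Bounded growth says
  exactly that both infinities are in the resolvent set.
\<close>

section \<open>Indefinite integrals\<close>

text \<open>Replaces almost everywhere differentiation of indefinite integrals: the defect of an
  integral identity over an interval is subadditive and quadratically small, hence zero.\<close>

lemma subadditive_quadratic_nonpos:
  fixes D :: "real \<Rightarrow> real \<Rightarrow> real" and W :: "real \<Rightarrow> real"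
  assumes "a \<le> b" and W: "continuous_on {a..b} W" and mono: "mono_on {a..b} W"
    and add: "\<And>s u t. a \<le> s \<Longrightarrow> s \<le> u \<Longrightarrow> u \<le> t \<Longrightarrow> t \<le> b \<Longrightarrow> D s t \<le> D s u + D u t"
    and quad: "\<And>s t. a \<le> s \<Longrightarrow> s \<le> t \<Longrightarrow> t \<le> b \<Longrightarrow> D s t \<le> C * (W t - W s)\<^sup>2"
  shows "D a b \<le> 0"
proof -
  have *: "a \<le> s \<Longrightarrow> s \<le> t \<Longrightarrow> t \<le> b \<Longrightarrow> D s t \<le> C * (W t - W s)\<^sup>2 / 2 ^ k" for k s t
  proof (induction k arbitrary: s t)
    case 0
    then show ?case using quad by simp
  next
    case (Suc k)
    have "W s \<le> W t"
      using Suc.prems mono by (auto simp: mono_on_def)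
    then have "W s \<le> (W s + W t) / 2" "(W s + W t) / 2 \<le> W t"
      by auto
    moreover have "continuous_on {s..t} W"
      using W by (rule continuous_on_subset) (use Suc.prems in auto)
    \<comment> \<open>The interval is bisected in the value of \<open>W\<close>, not in time: two
      pieces with half the increment each contribute a quarter of the square, so the bound halves
      with every round.\<close>
    ultimately obtain u where u: "s \<le> u" "u \<le> t" "W u = (W s + W t) / 2"
      using IVT'[of W s "(W s + W t) / 2" t] Suc.prems by auto
    have "D s t \<le> D s u + D u t"
      using add u Suc.prems by auto
    also have "\<dots> \<le> C * (W u - W s)\<^sup>2 / 2 ^ k + C * (W t - W u)\<^sup>2 / 2 ^ k"
      using Suc.IH[of s u] Suc.IH[of u t] u(1,2) Suc.prems by (intro add_mono) simp_all
    also have "\<dots> = C * (W t - W s)\<^sup>2 / 2 ^ Suc k"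
      unfolding u(3) by (simp add: power2_eq_square field_simps)
    finally show ?case .
  qed
  have "(\<lambda>k. C * (W b - W a)\<^sup>2 / 2 ^ k) \<longlonglongrightarrow> 0"
    using LIMSEQ_divide_realpow_zero[of 2 "C * (W b - W a)\<^sup>2"] by simp
  then show ?thesis
    using *[of a b] \<open>a \<le> b\<close> by (intro LIMSEQ_le_const) auto
qed

lemma integral_split:
  fixes f :: "real \<Rightarrow> 'a::euclidean_space"
  assumes "f integrable_on {a..b}" "a \<le> s" "s \<le> u" "u \<le> t" "t \<le> b"
  shows "integral {s..t} f = integral {s..u} f + integral {u..t} f"
proof -
  have "f integrable_on {s..t}"
    using assms integrable_on_subinterval[of f "{a..b}" s t] by auto
  then show ?thesis
    using Henstock_Kurzweil_Integration.integral_combine[of s u t f] assms by simp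
qed

text \<open>A continuous function on a compact interval is bounded and measurable, so it may
  multiply an integrable one. The general bilinear form serves scalar and matrix products
  alike.\<close>

lemma absolutely_integrable_continuous_bilinear:
  fixes h :: "'a::euclidean_space \<Rightarrow> 'b::euclidean_space \<Rightarrow> 'c::euclidean_space"
  assumes "bounded_bilinear h" "continuous_on {a..b} G" "f absolutely_integrable_on {a..b :: real}"
  shows "(\<lambda>r. h (G r) (f r)) absolutely_integrable_on {a..b}"
proof (rule absolutely_integrable_bounded_measurable_product[of h G "{a..b}" f])
  show "bilinear h"
    using assms(1) by (simp add: bilinear_conv_bounded_bilinear)
  show "G \<in> borel_measurable (lebesgue_on {a..b})"
    using assms(2) by (rule continuous_imp_measurable_on_sets_lebesgue) simp
  show "bounded (G ` {a..b})"
    using assms(2) by (intro compact_imp_bounded compact_continuous_image) simp_all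
qed (use assms in simp_all)

lemma indefinite_integral_mono_continuous:
  fixes w :: "real \<Rightarrow> real"
  assumes "w integrable_on {a..b}" "\<And>r. 0 \<le> w r"
  shows "mono_on {a..b} (\<lambda>t. integral {a..t} w)" "continuous_on {a..b} (\<lambda>t. integral {a..t} w)"
    "a \<le> s \<Longrightarrow> s \<le> t \<Longrightarrow> t \<le> b \<Longrightarrow> integral {a..t} w - integral {a..s} w = integral {s..t} w"
proof -
  show *: "integral {a..t} w - integral {a..s} w = integral {s..t} w"
    if "a \<le> s" "s \<le> t" "t \<le> b" for s t
    using integral_split[of w a b a s t] that assms(1) by simp
  have pos: "0 \<le> integral {s..t} w" if "a \<le> s" "s \<le> t" "t \<le> b" for s t
    using integrable_on_subinterval[OF assms(1)] that assms(2) by (intro integral_nonneg) auto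
  show "mono_on {a..b} (\<lambda>t. integral {a..t} w)"
  proof (rule mono_onI)
    fix r s assume "r \<in> {a..b}" "s \<in> {a..b}" "r \<le> s"
    then show "integral {a..r} w \<le> integral {a..s} w"
      using *[of r s] pos[of r s] by auto
  qed
  show "continuous_on {a..b} (\<lambda>t. integral {a..t} w)"
    by (rule indefinite_integral_continuous_1[OF assms(1)])
qed

text \<open>Formally the integrand is the derivative of \<open>exp (2 * W r) / 2\<close>, but
  \<open>W\<close> is only an indefinite integral, so the defect \<open>D\<close> is estimated
  instead. The exponent 2 produces the factor one half that later makes the Picard map a
  contraction.\<close>

lemma integral_exp_weight_le:
  fixes w :: "real \<Rightarrow> real"
  assumes w: "w absolutely_integrable_on {s..t}" "\<And>r. 0 \<le> w r" and "s \<le> t"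
  defines "W \<equiv> \<lambda>u. integral {s..u} w"
  shows "(\<lambda>r. w r * exp (2 * W r)) integrable_on {s..t}"
    and "integral {s..t} (\<lambda>r. w r * exp (2 * W r)) \<le> exp (2 * W t) / 2"
proof -
  have wi: "w integrable_on {s..t}"
    using w(1) by (rule set_lebesgue_integral_eq_integral(1))
  note W = indefinite_integral_mono_continuous[OF wi w(2), folded W_def]
  have Wmono: "W u \<le> W v" if "s \<le> u" "u \<le> v" "v \<le> t" for u v
    using W(1) that by (auto simp: mono_on_def)
  define f where "f = (\<lambda>r. w r * exp (2 * W r))"
  have "(\<lambda>r. exp (2 * W r) *\<^sub>R w r) absolutely_integrable_on {s..t}"
    by (intro absolutely_integrable_continuous_bilinear[OF bounded_bilinear_scaleR _ w(1)] continuous_intros W)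
  then show fi: "f integrable_on {s..t}"
    unfolding f_def by (auto simp: mult.commute dest: set_lebesgue_integral_eq_integral(1))
  define D where "D = (\<lambda>u v. integral {u..v} f - (exp (2 * W v) - exp (2 * W u)) / 2)"
  have "D s t \<le> 0"
  proof (rule subadditive_quadratic_nonpos[where C = "2 * exp (2 * W t)", OF \<open>s \<le> t\<close> W(2) W(1)])
    fix p u v assume "s \<le> p" "p \<le> u" "u \<le> v" "v \<le> t"
    then show "D p v \<le> D p u + D u v"
      using integral_split[OF fi, of p u v] by (simp add: D_def field_simps)
  next
    fix u v assume uv: "s \<le> u" "u \<le> v" "v \<le> t"
    define d where "d = W v - W u"
    have d: "0 \<le> d" using Wmono[OF uv] by (simp add: d_def)
    have "integral {u..v} f \<le> integral {u..v} (\<lambda>r. exp (2 * W v) * w r)"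
    proof (rule integral_le)
      show "f integrable_on {u..v}" "(\<lambda>r. exp (2 * W v) * w r) integrable_on {u..v}"
        using uv fi wi integrable_on_subinterval[of _ "{s..t}" u v]
        by (auto intro!: integrable_on_mult_right)
      fix r assume r: "r \<in> {u..v}"
      have "w r * exp (2 * W r) \<le> w r * exp (2 * W v)"
        using Wmono[of r v] r uv w(2)[of r] by (intro mult_left_mono) auto
      then show "f r \<le> exp (2 * W v) * w r"
        by (simp add: f_def mult.commute)
    qed
    also have "\<dots> = exp (2 * W v) * d"
      using W(3)[OF uv] by (simp add: d_def W_def)
    finally have 1: "integral {u..v} f \<le> exp (2 * W v) * d" .
    have e: "exp (2 * W u) = exp (2 * W v) * exp (- (2 * d))"
      by (simp add: d_def flip: exp_add)
    have "1 + (- (2 * d)) \<le> exp (- (2 * d))" by (rule exp_ge_add_one_self)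
    then have E: "exp (2 * W v) * (1 - 2 * d) \<le> exp (2 * W u)"
      unfolding e by (intro mult_left_mono) auto
    have "1 + 2 * d \<le> exp (2 * d)" by (rule exp_ge_add_one_self)
    then have "exp (2 * W u) * (1 + 2 * d) \<le> exp (2 * W u) * exp (2 * d)"
      by (intro mult_left_mono) auto
    also have "\<dots> = exp (2 * W v)" by (simp add: d_def flip: exp_add)
    finally have E2: "exp (2 * W u) * 2 * d \<le> exp (2 * W v) - exp (2 * W u)"
      by (simp add: algebra_simps)
    \<comment> \<open>The integral was bounded with the value of the exponential at the right end,
      the increment from below with its value at the left end. These values differ by at most a
      multiple of \<open>d\<close>, so the defect is quadratic in \<open>d\<close>.\<close>
    have "D u v \<le> exp (2 * W v) * d - exp (2 * W u) * d"
      using 1 E2 by (simp add: D_def field_simps)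
    also have "\<dots> = (exp (2 * W v) - exp (2 * W u)) * d"
      by (simp add: algebra_simps)
    also have "\<dots> \<le> (exp (2 * W v) * (2 * d)) * d"
      using E d by (intro mult_right_mono) (auto simp: algebra_simps)
    also have "\<dots> \<le> (exp (2 * W t) * (2 * d)) * d"
      using Wmono[of v t] uv d by (intro mult_right_mono) auto
    finally show "D u v \<le> 2 * exp (2 * W t) * (W v - W u)\<^sup>2"
      by (simp add: d_def power2_eq_square algebra_simps)
  qed
  then show "integral {s..t} f \<le> exp (2 * W t) / 2"
    using exp_ge_zero[of "2 * W s"] unfolding D_def by argo
qed

text \<open>Integration by parts for indefinite integrals. Freezing \<open>G\<close> at its right
  value and \<open>F\<close> at its left value makes the identity exact over each interval; the
  error of this replacement is quadratic in the integral of \<open>w\<close>.\<close>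

lemma has_integral_product_rule:
  fixes F f :: "real \<Rightarrow> 'a::euclidean_space" and G g :: "real \<Rightarrow> real"
  assumes "a \<le> b" and fa: "f absolutely_integrable_on {a..b}" and ga: "g absolutely_integrable_on {a..b}"
    and F: "\<And>u v. a \<le> u \<Longrightarrow> u \<le> v \<Longrightarrow> v \<le> b \<Longrightarrow> (f has_integral F v - F u) {u..v}"
    and G: "\<And>u v. a \<le> u \<Longrightarrow> u \<le> v \<Longrightarrow> v \<le> b \<Longrightarrow> (g has_integral G v - G u) {u..v}"
    and Fc: "continuous_on {a..b} F" and Gc: "continuous_on {a..b} G"
  shows "((\<lambda>r. G r *\<^sub>R f r + g r *\<^sub>R F r) has_integral G b *\<^sub>R F b - G a *\<^sub>R F a) {a..b}"
proof -
  define k where "k = (\<lambda>r. G r *\<^sub>R f r + g r *\<^sub>R F r)"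
  have ki: "k integrable_on {a..b}"
    unfolding k_def
    using absolutely_integrable_continuous_bilinear[OF bounded_bilinear_scaleR Gc fa]
      absolutely_integrable_continuous_bilinear[OF
        bounded_bilinear.flip[OF bounded_bilinear_scaleR] Fc ga]
    by (intro integrable_add set_lebesgue_integral_eq_integral(1))
  \<comment> \<open>One weight dominating both densities, so that its integral controls the
    increments of \<open>F\<close> and of \<open>G\<close> at once.\<close>
  define w where "w = (\<lambda>r. norm (f r) + norm (g r))"
  have wi: "w integrable_on {a..b}" and w0: "\<And>r. 0 \<le> w r"
    unfolding w_def using fa ga
    by (auto intro!: integrable_add simp: absolutely_integrable_on_def)
  define W where "W = (\<lambda>u. integral {a..u} w)"
  note W = indefinite_integral_mono_continuous[OF wi w0, folded W_def]
  have sub: "h integrable_on {u..v}" if "h integrable_on {a..b}" "a \<le> u" "v \<le> b"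
    for u v and h :: "real \<Rightarrow> 'c::banach"
    using integrable_on_subinterval[OF that(1), of u v] that by auto
  have inc: "norm (F v - F u) \<le> integral {u..v} w \<and> \<bar>G v - G u\<bar> \<le> integral {u..v} w"
    if uv: "a \<le> u" "u \<le> v" "v \<le> b" for u v
  proof
    have "f integrable_on {u..v}" "g integrable_on {u..v}"
      using F[OF uv] G[OF uv] by blast+
    moreover have "w integrable_on {u..v}" using sub[OF wi] uv by auto
    ultimately have "norm (integral {u..v} f) \<le> integral {u..v} w"
        "norm (integral {u..v} g) \<le> integral {u..v} w"
      unfolding w_def by (intro integral_norm_bound_integral; simp)+
    then show "norm (F v - F u) \<le> integral {u..v} w" "\<bar>G v - G u\<bar> \<le> integral {u..v} w"
      using integral_unique[OF F[OF uv]] integral_unique[OF G[OF uv]] by auto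
  qed
  define D where "D = (\<lambda>u v. norm (G v *\<^sub>R F v - G u *\<^sub>R F u - integral {u..v} k))"
  have "D a b \<le> 0"
  proof (rule subadditive_quadratic_nonpos[where C = 1, OF \<open>a \<le> b\<close> W(2) W(1)])
    fix p u v assume "a \<le> p" "p \<le> u" "u \<le> v" "v \<le> b"
    then have "integral {p..v} k = integral {p..u} k + integral {u..v} k"
      by (intro integral_split[OF ki])
    then have eq: "G v *\<^sub>R F v - G p *\<^sub>R F p - integral {p..v} k
      = (G u *\<^sub>R F u - G p *\<^sub>R F p - integral {p..u} k)
        + (G v *\<^sub>R F v - G u *\<^sub>R F u - integral {u..v} k)"
      by simp
    show "D p v \<le> D p u + D u v"
      unfolding D_def eq by (rule norm_triangle_ineq)
  next
    fix u v assume uv: "a \<le> u" "u \<le> v" "v \<le> b"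
    define d where "d = integral {u..v} w"
    \<comment> \<open>With frozen coefficients the integral telescopes:
      \<open>G v (F v - F u) + (G v - G u) F u\<close> is the increment of the product.\<close>
    have "((\<lambda>r. G v *\<^sub>R f r + g r *\<^sub>R F u) has_integral
           (G v *\<^sub>R (F v - F u) + (G v - G u) *\<^sub>R F u)) {u..v}"
      by (rule has_integral_add[OF has_integral_cmul[OF F[OF uv]] has_integral_scaleR_left[OF G[OF uv]]])
    moreover have "(k has_integral integral {u..v} k) {u..v}"
      using sub[OF ki] uv by (intro integrable_integral) auto
    ultimately have I: "((\<lambda>r. (G v *\<^sub>R f r + g r *\<^sub>R F u) - k r) has_integral
        (G v *\<^sub>R (F v - F u) + (G v - G u) *\<^sub>R F u) - integral {u..v} k) {u..v}"
      by (rule has_integral_diff)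
    have "norm ((G v *\<^sub>R (F v - F u) + (G v - G u) *\<^sub>R F u) - integral {u..v} k)
        \<le> integral {u..v} (\<lambda>r. d * w r)"
      unfolding integral_unique[OF I, symmetric]
    proof (rule integral_norm_bound_integral)
      show "(\<lambda>r. G v *\<^sub>R f r + g r *\<^sub>R F u - k r) integrable_on {u..v}"
        using I by blast
      show "(\<lambda>r. d * w r) integrable_on {u..v}"
        using sub[OF wi] uv by (intro integrable_on_mult_right) auto
      fix r assume r: "r \<in> {u..v}"
      have mono: "integral {p..q} w \<le> d" if "u \<le> p" "p \<le> q" "q \<le> v" for p q
        unfolding d_def using that uv w0
        by (intro integral_subset_le sub[OF wi]) auto
      have 1: "\<bar>G v - G r\<bar> \<le> d" "norm (F r - F u) \<le> d"
        using inc[of r v] inc[of u r] mono[of r v] mono[of u r] r uv by auto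
      have "G v *\<^sub>R f r + g r *\<^sub>R F u - k r = (G v - G r) *\<^sub>R f r - g r *\<^sub>R (F r - F u)"
        by (simp add: k_def algebra_simps)
      also have "norm \<dots> \<le> \<bar>G v - G r\<bar> * norm (f r) + \<bar>g r\<bar> * norm (F r - F u)"
        by (rule order_trans[OF norm_triangle_ineq4]) simp
      also have "\<dots> \<le> d * norm (f r) + \<bar>g r\<bar> * d"
        using 1 by (intro add_mono mult_mono) auto
      finally show "norm (G v *\<^sub>R f r + g r *\<^sub>R F u - k r) \<le> d * w r"
        by (simp add: w_def algebra_simps)
    qed
    also have "\<dots> = d\<^sup>2"
      by (simp add: d_def power2_eq_square)
    finally show "D u v \<le> 1 * (W v - W u)\<^sup>2"
      using W(3)[OF uv] unfolding D_def d_def W_def by (simp add: algebra_simps)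
  qed
  then have "G b *\<^sub>R F b - G a *\<^sub>R F a = integral {a..b} k"
    by (simp add: D_def)
  then show ?thesis
    using integrable_integral[OF ki] by (simp add: k_def)
qed

section \<open>Existence and uniqueness of evolution operators\<close>

lemma bounded_bilinear_matrix_mult:
  "bounded_bilinear ((**) :: real^'n^'n \<Rightarrow> real^'n^'n \<Rightarrow> real^'n^'n)"
  unfolding bilinear_conv_bounded_bilinear[symmetric] bilinear_def
  by (auto intro!: linearI
      simp: vec_eq_iff matrix_matrix_mult_def sum.distrib sum_distrib_left algebra_simps)

lemma locally_integrable_matrix_mult:
  fixes B x :: "real \<Rightarrow> real^'n^'n"
  assumes "locally_integrable B" "continuous_on {a..b} x"
  shows "(\<lambda>r. B r ** x r) absolutely_integrable_on {a..b}"
    and "(\<lambda>r. B r ** x r) integrable_on {a..b}"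
proof -
  show "(\<lambda>r. B r ** x r) absolutely_integrable_on {a..b}"
    using absolutely_integrable_continuous_bilinear[OF
        bounded_bilinear.flip[OF bounded_bilinear_matrix_mult] assms(2), of B] assms(1)
    by (simp add: locally_integrable_def)
  then show "(\<lambda>r. B r ** x r) integrable_on {a..b}"
    by (rule set_lebesgue_integral_eq_integral(1))
qed

text \<open>The norm of the matrix type is the Frobenius norm, not \<open>mat_norm\<close>. Each row
  of the product is a combination of the rows of \<open>X\<close>, to which Cauchy-Schwarz
  applies.\<close>

lemma norm_matrix_mult_le: "norm (A ** X) \<le> norm A * norm X" for A X :: "real^'n^'n"
proof -
  have row: "norm ((A ** X) $ i) \<le> norm (A $ i) * norm X" for i
  proof -
    have "(A ** X) $ i = (\<Sum>k\<in>UNIV. (A $ i $ k) *\<^sub>R X $ k)"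
      by (simp add: vec_eq_iff matrix_matrix_mult_def)
    also have "norm \<dots> \<le> (\<Sum>k\<in>UNIV. \<bar>A $ i $ k\<bar> * \<bar>norm (X $ k)\<bar>)"
      by (rule order_trans[OF norm_sum]) simp
    also have "\<dots> \<le> L2_set (\<lambda>k. A $ i $ k) UNIV * L2_set (\<lambda>k. norm (X $ k)) UNIV"
      by (rule L2_set_mult_ineq)
    finally show ?thesis
      by (simp add: norm_vec_def L2_set_def)
  qed
  have "norm (A ** X) \<le> L2_set (\<lambda>i. norm (A $ i) * norm X) UNIV"
    unfolding norm_vec_def[of "A ** X"] by (intro L2_set_mono row) auto
  also have "\<dots> = norm A * norm X"
    by (simp add: norm_vec_def[of A] L2_set_left_distrib)
  finally show ?thesis .
qed

section \<open>Weighted norms and the forward initial value problem\<close>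

definition weight :: "(real \<Rightarrow> real^'n^'n) \<Rightarrow> real \<Rightarrow> real \<Rightarrow> real" where
  "weight B s t = integral {s..t} (\<lambda>r. norm (B r))"

lemma weight_integrable:
  fixes B :: "real \<Rightarrow> real^'n^'n"
  assumes "locally_integrable B"
  shows "(\<lambda>r. norm (B r)) absolutely_integrable_on {a..b}"
proof (rule nonnegative_absolutely_integrable_1)
  show "(\<lambda>r. norm (B r)) integrable_on {a..b}"
    using assms
    by (auto simp: locally_integrable_def absolutely_integrable_on_def intro!: integrable_on_mult_right)
qed auto

lemma continuous_weight:
  fixes B :: "real \<Rightarrow> real^'n^'n"
  assumes "locally_integrable B"
  shows "continuous_on {s..t} (weight B s)"
  unfolding weight_def[abs_def]
  by (intro indefinite_integral_continuous_1 set_lebesgue_integral_eq_integral(1)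
      weight_integrable assms)

text \<open>The integral operator halves the norm weighted with
  \<open>exp (-2 * weight B s t)\<close>. Existence (by contraction) and uniqueness (by a maximum
  that must vanish) both rest on this.\<close>

lemma norm_integral_weighted_le:
  fixes B x :: "real \<Rightarrow> real^'n^'n"
  assumes B: "locally_integrable B" and "s \<le> t" and x: "continuous_on {s..t} x"
    and le: "\<And>r. r \<in> {s..t} \<Longrightarrow> norm (x r) \<le> M * exp (2 * weight B s r)"
  shows "norm (integral {s..t} (\<lambda>r. B r ** x r)) \<le> M * exp (2 * weight B s t) / 2"
proof -
  define w where "w = (\<lambda>r. norm (B r))"
  have w0: "0 \<le> w r" for r
    by (simp add: w_def)
  have "w absolutely_integrable_on {s..t}"
    unfolding w_def by (rule weight_integrable[OF B])
  note W = integral_exp_weight_le[OF this w0 \<open>s \<le> t\<close>]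
  have Weq: "integral {s..u} w = weight B s u" for u
    by (simp add: w_def weight_def)
  \<comment> \<open>The assumed bound at \<open>r = s\<close> forces \<open>M\<close> to be
    nonnegative.\<close>
  have "0 \<le> M * exp (2 * weight B s s)"
    using le[of s] \<open>s \<le> t\<close> order_trans[OF norm_ge_zero] by auto
  then have M: "0 \<le> M"
    by (simp add: zero_le_mult_iff)
  have "norm (integral {s..t} (\<lambda>r. B r ** x r))
      \<le> integral {s..t} (\<lambda>r. M * (w r * exp (2 * weight B s r)))"
  proof (rule integral_norm_bound_integral)
    show "(\<lambda>r. B r ** x r) integrable_on {s..t}"
      by (rule locally_integrable_matrix_mult(2)[OF B x])
    show "(\<lambda>r. M * (w r * exp (2 * weight B s r))) integrable_on {s..t}"
      using W(1) unfolding Weq by (rule integrable_on_mult_right)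
    fix r assume r: "r \<in> {s..t}"
    have "norm (B r ** x r) \<le> w r * norm (x r)"
      unfolding w_def by (rule norm_matrix_mult_le)
    also have "\<dots> \<le> w r * (M * exp (2 * weight B s r))"
      using le[OF r] w0 by (rule mult_left_mono)
    finally show "norm (B r ** x r) \<le> M * (w r * exp (2 * weight B s r))"
      by (simp add: mult_ac)
  qed
  also have "\<dots> = M * integral {s..t} (\<lambda>r. w r * exp (2 * weight B s r))"
    by simp
  also have "\<dots> \<le> M * (exp (2 * weight B s t) / 2)"
    using W(2) M unfolding Weq by (rule mult_left_mono)
  finally show ?thesis by simp
qed

text \<open>Cutting off with \<open>max\<close> freezes the integral to the left of
  \<open>s\<close>, so that the forward problem can be posed in the space of bounded continuous
  functions on the whole line. Continuity is local, hence it suffices to look at times up to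
  \<open>b\<close>.\<close>

lemma continuous_on_integral_max:
  fixes f :: "real \<Rightarrow> 'a::euclidean_space"
  assumes "\<And>b. f integrable_on {s..b}"
  shows "continuous_on UNIV (\<lambda>t. integral {s..max s t} f)"
proof (rule continuous_at_imp_continuous_on, rule ballI)
  fix t :: real
  define b where "b = max s t + 1"
  have "continuous_on {..b} (\<lambda>t. integral {s..max s t} f)"
    by (rule continuous_on_compose2[OF indefinite_integral_continuous_1[OF assms[of b]]])
      (auto simp: b_def intro!: continuous_intros)
  then have "continuous_on {..<b} (\<lambda>t. integral {s..max s t} f)"
    by (rule continuous_on_subset) auto
  then show "isCont (\<lambda>t. integral {s..max s t} f) t"
    by (simp add: continuous_on_eq_continuous_at b_def)
qed

text \<open>Picard iteration contracts by one half in the norm weighted with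
  \<open>exp (-2 * weight B s t)\<close>, whatever the length of the interval.\<close>

lemma forward_solution_exists:
  fixes B :: "real \<Rightarrow> real^'n^'n"
  assumes B: "locally_integrable B"
  shows "\<exists>x. continuous_on UNIV x \<and>
    (\<forall>t\<ge>s. ((\<lambda>r. B r ** x r) has_integral (x t - mat 1)) {s..t})"
proof -
  define W where "W = (\<lambda>t. weight B s (max s t))"
  \<comment> \<open>The unknown is written as \<open>lift y\<close> with \<open>y\<close> bounded
    and continuous, which turns the weighted norm into the supremum norm of a complete
    space.\<close>
  define lift where "lift = (\<lambda>(y :: real \<Rightarrow>\<^sub>C (real^'n^'n)) r. exp (2 * W r) *\<^sub>R y r)"
  define picard where "picard = (\<lambda>y t. mat 1 + integral {s..max s t} (\<lambda>r. B r ** lift y r))"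
  have Wc: "continuous_on UNIV W"
    unfolding W_def weight_def
    by (intro continuous_on_integral_max set_lebesgue_integral_eq_integral(1) weight_integrable B)
  have W0: "0 \<le> W t" for t
    unfolding W_def weight_def
    by (intro integral_nonneg set_lebesgue_integral_eq_integral(1) weight_integrable B) auto
  have lc: "continuous_on S (lift y)" for S y
    unfolding lift_def
    by (intro continuous_intros continuous_on_subset[OF Wc]) auto
  have li: "(\<lambda>r. B r ** lift y r) integrable_on {s..t}" for y t
    by (intro locally_integrable_matrix_mult(2) B lc)
  have pc: "continuous_on UNIV (picard y)" for y
    unfolding picard_def by (intro continuous_intros continuous_on_integral_max li)
  have est: "norm (integral {s..max s t} (\<lambda>r. B r ** x r)) \<le> M * exp (2 * W t) / 2"
    if "continuous_on UNIV x" "\<And>r. norm (x r) \<le> M * exp (2 * W r)" for x :: "real \<Rightarrow> real^'n^'n" and M t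
    unfolding W_def
  proof (rule norm_integral_weighted_le[OF B])
    fix r assume "r \<in> {s..max s t}"
    then show "norm (x r) \<le> M * exp (2 * weight B s r)"
      using that(2)[of r] by (auto simp: W_def max_def split: if_splits)
  qed (use that(1) in \<open>auto intro: continuous_on_subset\<close>)
  \<comment> \<open>The Picard image is at most a constant times \<open>exp (2 * W t)\<close>; after
    division by this weight it is bounded, so the iteration stays in the space.\<close>
  have "\<exists>z :: real \<Rightarrow>\<^sub>C (real^'n^'n). \<forall>t. z t = exp (- (2 * W t)) *\<^sub>R picard y t" for y
  proof -
    have "(\<lambda>t. exp (- (2 * W t)) *\<^sub>R picard y t) \<in> bcontfun"
    proof (rule bcontfun_normI)
      show "continuous_on UNIV (\<lambda>t. exp (- (2 * W t)) *\<^sub>R picard y t)"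
        by (intro continuous_intros pc Wc)
      fix t
      have "norm (picard y t) \<le> norm (mat 1 :: real^'n^'n)
          + norm (integral {s..max s t} (\<lambda>r. B r ** lift y r))"
        unfolding picard_def by (rule norm_triangle_ineq)
      also have "\<dots> \<le> norm (mat 1 :: real^'n^'n) * exp (2 * W t) + norm y * exp (2 * W t) / 2"
      proof (intro add_mono est lc)
        show "norm (mat 1 :: real^'n^'n) \<le> norm (mat 1 :: real^'n^'n) * exp (2 * W t)"
          using W0[of t] mult_left_mono[of 1 "exp (2 * W t)" "norm (mat 1 :: real^'n^'n)"] by simp
        show "norm (lift y r) \<le> norm y * exp (2 * W r)" for r
          using norm_bounded[of y r] by (simp add: lift_def mult.commute mult_left_mono)
      qed
      finally have "exp (- (2 * W t)) * norm (picard y t) \<le> exp (- (2 * W t)) *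
          (norm (mat 1 :: real^'n^'n) * exp (2 * W t) + norm y * exp (2 * W t) / 2)"
        by (intro mult_left_mono) auto
      also have "\<dots> = norm (mat 1 :: real^'n^'n) + norm y / 2"
        by (simp add: exp_minus field_simps)
      finally show "norm (exp (- (2 * W t)) *\<^sub>R picard y t) \<le> norm (mat 1 :: real^'n^'n) + norm y / 2"
        by simp
    qed
    then obtain z where z: "(\<lambda>t. exp (- (2 * W t)) *\<^sub>R picard y t) = apply_bcontfun z"
      by (rule bcontfunE)
    have "z t = exp (- (2 * W t)) *\<^sub>R picard y t" for t
      using fun_cong[OF z, of t] by simp
    then show ?thesis by blast
  qed
  then have "\<exists>T :: (real \<Rightarrow>\<^sub>C (real^'n^'n)) \<Rightarrow> (real \<Rightarrow>\<^sub>C (real^'n^'n)).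
      \<forall>y t. T y t = exp (- (2 * W t)) *\<^sub>R picard y t"
    by (intro choice) blast
  then obtain T :: "(real \<Rightarrow>\<^sub>C (real^'n^'n)) \<Rightarrow> (real \<Rightarrow>\<^sub>C (real^'n^'n))"
    where T: "\<And>y t. T y t = exp (- (2 * W t)) *\<^sub>R picard y t"
    by blast
  have "dist (T y) (T z) \<le> (1 / 2) * dist y z" for y z
  proof (rule dist_bound)
    fix t
    have "picard y t - picard z t
      = integral {s..max s t} (\<lambda>r. B r ** lift y r) - integral {s..max s t} (\<lambda>r. B r ** lift z r)"
      by (simp add: picard_def)
    also have "\<dots> = integral {s..max s t} (\<lambda>r. B r ** lift y r - B r ** lift z r)"
      by (rule Henstock_Kurzweil_Integration.integral_diff[symmetric]) (rule li)+
    also have "\<dots> = integral {s..max s t} (\<lambda>r. B r ** (lift y r - lift z r))"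
      by (simp add: bounded_bilinear.diff_right[OF bounded_bilinear_matrix_mult])
    finally have eq: "picard y t - picard z t = \<dots>" .
    have "norm (picard y t - picard z t) \<le> dist y z * exp (2 * W t) / 2"
      unfolding eq
    proof (rule est)
      show "continuous_on UNIV (\<lambda>r. lift y r - lift z r)"
        by (intro continuous_intros lc)
      show "norm (lift y r - lift z r) \<le> dist y z * exp (2 * W r)" for r
        using dist_bounded[of y r z]
        by (simp add: lift_def dist_norm mult.commute mult_left_mono flip: scaleR_diff_right)
    qed
    then have "exp (- (2 * W t)) * norm (picard y t - picard z t)
        \<le> exp (- (2 * W t)) * (dist y z * exp (2 * W t) / 2)"
      by (intro mult_left_mono) auto
    also have "\<dots> = (1 / 2) * dist y z"
      by (simp add: exp_minus field_simps)
    finally show "dist (T y t) (T z t) \<le> (1 / 2) * dist y z"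
      by (simp add: T dist_norm flip: scaleR_diff_right)
  qed
  then obtain y where y: "T y = y"
    using banach_fix_type[of "1 / 2" T] by auto
  have *: "lift y t = picard y t" for t
    using T[of y t] unfolding y by (simp add: lift_def exp_minus)
  have "((\<lambda>r. B r ** lift y r) has_integral (lift y t - mat 1)) {s..t}" if "s \<le> t" for t
    using integrable_integral[OF li[of y t]] that unfolding *[of t] by (simp add: picard_def max_def)
  then show ?thesis
    using lc by blast
qed

section \<open>Two-sided solutions: time reversal, uniqueness, existence\<close>

definition solves :: "(real \<Rightarrow> real^'n^'n) \<Rightarrow> (real \<Rightarrow> real^'n^'n) \<Rightarrow> bool" where
  "solves B x \<longleftrightarrow> continuous_on UNIV x \<and>
     (\<forall>u v. u \<le> v \<longrightarrow> ((\<lambda>r. B r ** x r) has_integral (x v - x u)) {u..v})"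

text \<open>\<open>- B (- r)\<close> is the coefficient of the time-reversed equation; passing to it
  carries forward existence and uniqueness over to the past.\<close>

lemma locally_integrable_reflect:
  assumes "locally_integrable B"
  shows "locally_integrable (\<lambda>r. - B (- r))"
proof -
  have "(\<lambda>r. B (- r)) absolutely_integrable_on {a..b}" for a b
    using assms absolutely_integrable_reflect_real[where f = B and a = "- b" and b = "- a"]
    by (simp add: locally_integrable_def)
  from absolutely_integrable_scaleR_left[OF this, where c = "- 1"] show ?thesis
    by (simp add: locally_integrable_def)
qed

lemma matrix_mult_minus_left: "- A ** X = - (A ** X)" for A X :: "real^'n^'n"
  by (rule bounded_bilinear.minus_left[OF bounded_bilinear_matrix_mult])

lemma solves_reflect:
  assumes "solves B x"
  shows "solves (\<lambda>r. - B (- r)) (\<lambda>r. x (- r))"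
  unfolding solves_def
proof (intro conjI allI impI)
  show "continuous_on UNIV (\<lambda>r. x (- r))"
    using assms unfolding solves_def
    by (intro continuous_on_compose2[of UNIV x UNIV uminus]) (auto intro!: continuous_intros)
  fix u v :: real assume "u \<le> v"
  then have "((\<lambda>r. B r ** x r) has_integral (x (- u) - x (- v))) {- v..- u}"
    using assms by (auto simp: solves_def)
  then have I: "((\<lambda>r. B (- r) ** x (- r)) has_integral (x (- u) - x (- v))) {u..v}"
    using has_integral_reflect_real[of "\<lambda>r. B r ** x r" _ "- u" "- v"] by simp
  show "((\<lambda>r. - B (- r) ** x (- r)) has_integral (x (- v) - x (- u))) {u..v}"
    using has_integral_neg[OF I] by (simp add: matrix_mult_minus_left)
qed

text \<open>At a maximum point \<open>p\<close> of the weighted norm \<open>q\<close> of the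
  difference, the halving estimate gives \<open>q p \<le> q p / 2\<close>, so \<open>q\<close>
  vanishes.\<close>

lemma solves_unique_forward:
  fixes B :: "real \<Rightarrow> real^'n^'n"
  assumes B: "locally_integrable B" and x: "solves B x" and y: "solves B y" and eq: "x s = y s"
    and "s \<le> t"
  shows "x t = y t"
proof -
  define z where "z = (\<lambda>r. x r - y r)"
  have zc: "continuous_on S z" for S
    unfolding z_def using x y
    by (intro continuous_intros; auto simp: solves_def intro: continuous_on_subset)
  have zi: "z r = integral {s..r} (\<lambda>r. B r ** z r)" if "s \<le> r" for r
  proof -
    have "((\<lambda>r. B r ** x r) has_integral (x r - x s)) {s..r}"
      "((\<lambda>r. B r ** y r) has_integral (y r - y s)) {s..r}"
      using x y that by (auto simp: solves_def)
    from has_integral_diff[OF this] eq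
    have "((\<lambda>r. B r ** z r) has_integral z r) {s..r}"
      by (simp add: z_def bounded_bilinear.diff_right[OF bounded_bilinear_matrix_mult])
    then show ?thesis by (simp add: integral_unique)
  qed
  define q where "q = (\<lambda>r. exp (- (2 * weight B s r)) * norm (z r))"
  have "continuous_on {s..t} q"
    unfolding q_def by (intro continuous_intros continuous_weight[OF B] zc)
  then obtain p where p: "p \<in> {s..t}" "\<And>r. r \<in> {s..t} \<Longrightarrow> q r \<le> q p"
    using continuous_attains_sup[of "{s..t}" q] \<open>s \<le> t\<close> by auto
  have nz: "norm (z r) = q r * exp (2 * weight B s r)" for r
    by (simp add: q_def exp_minus)
  have "norm (z p) \<le> q p * exp (2 * weight B s p) / 2"
    unfolding zi[of p, OF atLeastAtMost_iff[THEN iffD1, OF p(1), THEN conjunct1]]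
  proof (rule norm_integral_weighted_le[OF B _ zc])
    show "norm (z r) \<le> q p * exp (2 * weight B s r)" if "r \<in> {s..p}" for r
      unfolding nz[of r] using p that by (intro mult_right_mono) auto
  qed (use p in auto)
  then have "q p \<le> 0"
    unfolding nz[of p] by (simp add: mult_le_0_iff)
  moreover have "q t \<le> q p" "0 \<le> q t"
    using p(2)[of t] \<open>s \<le> t\<close> by (auto simp: q_def)
  ultimately have "q t = 0" by simp
  then show ?thesis
    using nz[of t] by (simp add: z_def)
qed

lemma solves_unique:
  assumes "locally_integrable B" "solves B x" "solves B y" "x s = y s"
  shows "x = y"
proof
  fix t show "x t = y t"
  proof (cases "s \<le> t")
    case True
    then show ?thesis using solves_unique_forward[OF assms] by blast
  next
    case False
    then show ?thesis
      using solves_unique_forward[OF locally_integrable_reflect[OF assms(1)]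
          solves_reflect[OF assms(2)] solves_reflect[OF assms(3)], of "- s" "- t"] assms(4)
      by simp
  qed
qed

lemma has_integral_point:
  fixes f :: "real \<Rightarrow> 'a::euclidean_space"
  assumes "(f has_integral I) {s..s}"
  shows "I = 0"
  using has_integral_unique[OF assms, of 0] has_integral_refl(2)[of f s] by simp

text \<open>Replaces the two oriented identities anchored at \<open>s\<close> by one identity over
  arbitrary intervals, a form preserved by time reversal and right multiplication. Intervals on one
  side of \<open>s\<close> are handled by subtraction, those around it by joining.\<close>

lemma is_evolution_operator_iff:
  "is_evolution_operator B \<Phi> \<longleftrightarrow> (\<forall>s. solves B (\<lambda>t. \<Phi> t s) \<and> \<Phi> s s = mat 1)"
proof
  assume E: "is_evolution_operator B \<Phi>"
  then have fwd: "((\<lambda>r. B r ** \<Phi> r s) has_integral (\<Phi> t s - mat 1)) {s..t}" if "s \<le> t" for s t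
    using that by (auto simp: is_evolution_operator_def)
  have bwd: "((\<lambda>r. B r ** \<Phi> r s) has_integral (mat 1 - \<Phi> t s)) {t..s}" if "t \<le> s" for s t
    using that E by (auto simp: is_evolution_operator_def)
  have id: "\<Phi> s s = mat 1" for s
    using has_integral_point[OF fwd[of s s]] by simp
  have "((\<lambda>r. B r ** \<Phi> r s) has_integral (\<Phi> v s - \<Phi> u s)) {u..v}" if "u \<le> v" for s u v
  proof -
    consider "s \<le> u" | "u \<le> s" "s \<le> v" | "v \<le> s" using that by linarith
    then show ?thesis
    proof cases
      case 1
      then have "(\<lambda>r. B r ** \<Phi> r s) integrable_on {u..v}"
        using that integrable_on_subinterval[OF has_integral_integrable[OF fwd[of s v]], of u v]
        by auto
      then obtain I where I: "((\<lambda>r. B r ** \<Phi> r s) has_integral I) {u..v}" by blast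
      have "\<Phi> v s - mat 1 = \<Phi> u s - mat 1 + I"
        using has_integral_combine[OF 1 that fwd[OF 1] I] fwd[of s v] 1 that
        by (intro has_integral_unique) auto
      then have "I = \<Phi> v s - \<Phi> u s" by (simp add: algebra_simps)
      then show ?thesis using I by simp
    next
      case 2
      then show ?thesis
        using has_integral_combine[OF 2 bwd fwd] by (simp add: algebra_simps)
    next
      case 3
      then have "(\<lambda>r. B r ** \<Phi> r s) integrable_on {u..v}"
        using that integrable_on_subinterval[OF has_integral_integrable[OF bwd[of u s]], of u v]
        by auto
      then obtain I where I: "((\<lambda>r. B r ** \<Phi> r s) has_integral I) {u..v}" by blast
      have "mat 1 - \<Phi> u s = I + (mat 1 - \<Phi> v s)"
        using has_integral_combine[OF that 3 I bwd[OF 3]] bwd[of u s] 3 that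
        by (intro has_integral_unique) auto
      then have "I = \<Phi> v s - \<Phi> u s" by (simp add: algebra_simps)
      then show ?thesis using I by simp
    qed
  qed
  then show "\<forall>s. solves B (\<lambda>t. \<Phi> t s) \<and> \<Phi> s s = mat 1"
    using E id by (auto simp: solves_def is_evolution_operator_def)
next
  assume *: "\<forall>s. solves B (\<lambda>t. \<Phi> t s) \<and> \<Phi> s s = mat 1"
  show "is_evolution_operator B \<Phi>"
    unfolding is_evolution_operator_def
  proof (intro conjI allI impI)
    fix s t :: real
    have int: "((\<lambda>r. B r ** \<Phi> r s) has_integral \<Phi> v s - \<Phi> u s) {u..v}" if "u \<le> v" for u v
      using * that by (auto simp: solves_def)
    have id: "\<Phi> s s = mat 1" using * by blast
    show "((\<lambda>r. B r ** \<Phi> r s) has_integral \<Phi> t s - mat 1) {s..t}" if "s \<le> t"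
      using int[OF that] by (simp add: id)
    show "((\<lambda>r. B r ** \<Phi> r s) has_integral mat 1 - \<Phi> t s) {t..s}" if "t \<le> s"
      using int[OF that] by (simp add: id)
  qed (use * in \<open>auto simp: solves_def\<close>)
qed

text \<open>The forward solution is glued at \<open>s\<close> to the reflected forward solution of
  the time-reversed equation; both equal the identity there.\<close>

lemma evolution_operator_exists:
  fixes B :: "real \<Rightarrow> real^'n^'n"
  assumes B: "locally_integrable B"
  shows "\<exists>\<Phi>. is_evolution_operator B \<Phi>"
proof -
  have *: "\<exists>z. continuous_on UNIV z \<and>
    (\<forall>t\<ge>s. ((\<lambda>r. B r ** z r) has_integral (z t - mat 1)) {s..t}) \<and>
    (\<forall>t\<le>s. ((\<lambda>r. B r ** z r) has_integral (mat 1 - z t)) {t..s})" for s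
  proof -
    obtain x where x: "continuous_on UNIV x"
      "\<And>t. t \<ge> s \<Longrightarrow> ((\<lambda>r. B r ** x r) has_integral (x t - mat 1)) {s..t}"
      using forward_solution_exists[OF B, of s] by blast
    obtain y where y: "continuous_on UNIV y"
      "\<And>t. t \<ge> - s \<Longrightarrow> ((\<lambda>r. - B (- r) ** y r) has_integral (y t - mat 1)) {- s..t}"
      using forward_solution_exists[OF locally_integrable_reflect[OF B], of "- s"] by blast
    have "x s = mat 1" "y (- s) = mat 1"
      using has_integral_point[OF x(2)[of s]] has_integral_point[OF y(2)[of "- s"]] by simp_all
    define z where "z = (\<lambda>t. if t \<le> s then y (- t) else x t)"
    have "continuous_on ({..s} \<union> {s..}) z"
      unfolding z_def using \<open>x s = mat 1\<close> \<open>y (- s) = mat 1\<close>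
      by (intro continuous_on_If continuous_on_subset[OF x(1)]
          continuous_on_compose2[OF y(1), of _ uminus] continuous_intros) auto
    moreover have "{..s} \<union> {s..} = (UNIV :: real set)" by auto
    ultimately have "continuous_on UNIV z" by simp
    moreover have "((\<lambda>r. B r ** z r) has_integral (z t - mat 1)) {s..t}" if "t \<ge> s" for t
    proof -
      have "z t = x t"
        using that \<open>x s = mat 1\<close> \<open>y (- s) = mat 1\<close> by (auto simp: z_def)
      then show ?thesis
        using has_integral_spike_finite[of "{s}" "{s..t}" "\<lambda>r. B r ** z r" "\<lambda>r. B r ** x r"] x(2)[OF that]
        by (auto simp: z_def)
    qed
    moreover have "((\<lambda>r. B r ** z r) has_integral (mat 1 - z t)) {t..s}" if "t \<le> s" for t
    proof -
      have "((\<lambda>r. - B (- r) ** y r) has_integral (y (- t) - mat 1)) {- s..- t}"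
        using that by (intro y) auto
      from has_integral_neg[OF this]
      have "((\<lambda>r. B (- r) ** y r) has_integral (mat 1 - y (- t))) {- s..- t}"
        by (simp add: matrix_mult_minus_left)
      then have "((\<lambda>r. B r ** y (- r)) has_integral (mat 1 - y (- t))) {t..s}"
        using has_integral_reflect_real[of "\<lambda>r. B r ** y (- r)" _ s t] by simp
      then show ?thesis
        using that by (subst has_integral_cong[of _ _ "\<lambda>r. B r ** y (- r)"]) (auto simp: z_def)
    qed
    ultimately show ?thesis by blast
  qed
  from choice[OF allI[OF *]] obtain \<Psi> where "\<forall>s. continuous_on UNIV (\<Psi> s) \<and>
    (\<forall>t\<ge>s. ((\<lambda>r. B r ** \<Psi> s r) has_integral (\<Psi> s t - mat 1)) {s..t}) \<and>
    (\<forall>t\<le>s. ((\<lambda>r. B r ** \<Psi> s r) has_integral (mat 1 - \<Psi> s t)) {t..s})" ..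
  then have "is_evolution_operator B (\<lambda>t s. \<Psi> s t)"
    unfolding is_evolution_operator_def by simp
  then show ?thesis by (rule exI[where x = "\<lambda>t s. \<Psi> s t"])
qed

lemma evolution_operator_unique:
  assumes "locally_integrable B" "is_evolution_operator B \<Phi>" "is_evolution_operator B \<Psi>"
  shows "\<Phi> = \<Psi>"
proof (intro ext)
  fix t s
  have "(\<lambda>t. \<Phi> t s) = (\<lambda>t. \<Psi> t s)"
    using assms by (intro solves_unique[of B _ _ s]) (auto simp: is_evolution_operator_iff)
  then show "\<Phi> t s = \<Psi> t s" by meson
qed

lemma is_evolution_operator_evolution_operator:
  assumes "locally_integrable B"
  shows "is_evolution_operator B (evolution_operator B)"
  unfolding evolution_operator_def
  by (rule theI'[of "is_evolution_operator B"], rule ex_ex1I[OF evolution_operator_exists[OF assms]])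
    (rule evolution_operator_unique[OF assms])

lemma evolution_operator_refl:
  "locally_integrable B \<Longrightarrow> evolution_operator B s s = mat 1"
  by (drule is_evolution_operator_evolution_operator) (simp add: is_evolution_operator_iff)

text \<open>As functions of \<open>t\<close> both sides solve the same equation, and they agree at
  \<open>t = s\<close>.\<close>

lemma evolution_operator_cocycle:
  fixes B :: "real \<Rightarrow> real^'n^'n"
  assumes "locally_integrable B"
  shows "evolution_operator B t s ** evolution_operator B s r = evolution_operator B t r"
proof -
  let ?E = "evolution_operator B"
  have E: "solves B (\<lambda>t. ?E t s)" for s
    using is_evolution_operator_evolution_operator[OF assms, unfolded is_evolution_operator_iff]
    by (rule allE) (erule conjunct1)
  have lin: "bounded_linear (\<lambda>X :: real^'n^'n. X ** ?E s r)"
    by (rule bounded_bilinear.bounded_linear_left[OF bounded_bilinear_matrix_mult])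
  have "solves B (\<lambda>t. ?E t s ** ?E s r)"
    unfolding solves_def
  proof (intro conjI allI impI)
    show "continuous_on UNIV (\<lambda>t. ?E t s ** ?E s r)"
      using bounded_linear.continuous_on[OF lin] E[of s, unfolded solves_def, THEN conjunct1] .
    fix u v :: real assume "u \<le> v"
    then have "((\<lambda>q. B q ** ?E q s) has_integral (?E v s - ?E u s)) {u..v}"
      using E[of s] by (auto simp: solves_def)
    from has_integral_linear[OF this lin]
    show "((\<lambda>q. B q ** (?E q s ** ?E s r)) has_integral (?E v s ** ?E s r - ?E u s ** ?E s r)) {u..v}"
      by (simp add: o_def matrix_mul_assoc bounded_bilinear.diff_left[OF bounded_bilinear_matrix_mult])
  qed
  then have "(\<lambda>t. ?E t s ** ?E s r) = (\<lambda>t. ?E t r)"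
    by (rule solves_unique[OF assms _ E, of _ s]) (simp add: evolution_operator_refl[OF assms])
  from fun_cong[OF this, of t] show ?thesis .
qed

section \<open>Shifts and translations\<close>

lemma growth_rate_ln_derivative:
  assumes "growth_rate \<mu>"
  shows "((\<lambda>t. ln (\<mu> t)) has_real_derivative deriv \<mu> t / \<mu> t) (at t)"
proof -
  have "\<mu> t > 0" "(\<mu> has_real_derivative deriv \<mu> t) (at t)"
    using assms by (auto simp: growth_rate_def DERIV_deriv_iff_real_differentiable)
  then show ?thesis
    by (auto intro!: derivative_eq_intros)
qed

text \<open>\<open>deriv \<mu>\<close> may be discontinuous. The fundamental theorem of calculus
  still gives integrability, and monotonicity of \<open>\<mu>\<close> gives the sign that makes it
  absolute.\<close>

lemma growth_rate_ln_derivative_integrable: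
  assumes "growth_rate \<mu>"
  shows "(\<lambda>t. deriv \<mu> t / \<mu> t) absolutely_integrable_on {a..b}"
proof (cases "a \<le> b")
  case True
  show ?thesis
  proof (rule nonnegative_absolutely_integrable_1)
    have "((\<lambda>t. deriv \<mu> t / \<mu> t) has_integral ln (\<mu> b) - ln (\<mu> a)) {a..b}"
      using growth_rate_ln_derivative[OF assms] True
      by (intro fundamental_theorem_of_calculus)
        (auto simp: has_real_derivative_iff_has_vector_derivative[symmetric]
          intro: has_field_derivative_at_within)
    then show "(\<lambda>t. deriv \<mu> t / \<mu> t) integrable_on {a..b}" by blast
  next
    fix t
    have "mono_on UNIV \<mu>"
      using assms by (simp add: growth_rate_def strict_mono_mono)
    moreover have "(\<mu> has_real_derivative deriv \<mu> t) (at t)"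
      using assms by (auto simp: growth_rate_def DERIV_deriv_iff_real_differentiable)
    ultimately have "0 \<le> deriv \<mu> t"
      by (rule mono_on_imp_deriv_nonneg) simp
    then show "0 \<le> deriv \<mu> t / \<mu> t"
      using assms by (auto simp: growth_rate_def intro!: divide_nonneg_pos)
  qed
qed simp

lemma locally_integrable_shifted:
  assumes "locally_integrable A" "growth_rate \<mu>"
  shows "locally_integrable (shifted \<mu> A \<gamma>)"
proof -
  have "(\<lambda>t. (\<gamma> * (deriv \<mu> t / \<mu> t)) *\<^sub>R mat 1) absolutely_integrable_on {a..b}" for a b
    using absolutely_integrable_scaleR_right[where c = "mat 1", OF
        absolutely_integrable_scaleR_left[OF growth_rate_ln_derivative_integrable[OF assms(2)],
          where c = \<gamma>]]
    by simp
  then show ?thesis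
    using assms(1) unfolding locally_integrable_def shifted_def by (intro allI set_integral_diff(1)) auto
qed

lemma matrix_mult_scaleR:
  fixes A X :: "real^'n^'n"
  shows "(c *\<^sub>R A) ** X = c *\<^sub>R (A ** X)" "A ** (c *\<^sub>R X) = c *\<^sub>R (A ** X)"
  by (rule bounded_bilinear.scaleR_left[OF bounded_bilinear_matrix_mult],
      rule bounded_bilinear.scaleR_right[OF bounded_bilinear_matrix_mult])

text \<open>The scalar factor solves the scalar equation with coefficient
  \<open>- \<gamma> * (deriv \<mu> t / \<mu> t)\<close>; the product rule and the uniqueness of
  evolution operators do the rest.\<close>

lemma evolution_operator_shifted:
  fixes A :: "real \<Rightarrow> real^'n^'n"
  assumes A: "locally_integrable A" and \<mu>: "growth_rate \<mu>"
  shows "evolution_operator (shifted \<mu> A \<gamma>) t s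
    = exp (- \<gamma> * (ln (\<mu> t) - ln (\<mu> s))) *\<^sub>R evolution_operator A t s"
proof -
  let ?E = "evolution_operator A"
  define G where "G = (\<lambda>s t. exp (- \<gamma> * (ln (\<mu> t) - ln (\<mu> s))))"
  define g where "g = (\<lambda>s t. G s t * (- \<gamma> * (deriv \<mu> t / \<mu> t)))"
  have E: "solves A (\<lambda>t. ?E t s)" "?E s s = mat 1" for s
    using is_evolution_operator_evolution_operator[OF A, unfolded is_evolution_operator_iff] by blast+
  have Ec: "continuous_on S (\<lambda>t. ?E t s)" for S s
    using E(1)[of s] unfolding solves_def by (auto intro: continuous_on_subset)
  have dG: "(G s has_real_derivative g s t) (at t)" for s t
    unfolding G_def g_def
    by (rule derivative_eq_intros growth_rate_ln_derivative[OF \<mu>] refl | simp)+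
  then have Gc: "continuous_on S (G s)" for S s
    by (meson DERIV_isCont continuous_at_imp_continuous_on)
  have "solves (shifted \<mu> A \<gamma>) (\<lambda>t. G s t *\<^sub>R ?E t s)" for s
    unfolding solves_def
  proof (intro conjI allI impI)
    show "continuous_on UNIV (\<lambda>t. G s t *\<^sub>R ?E t s)"
      by (intro continuous_intros Gc Ec)
    fix u v :: real assume uv: "u \<le> v"
    have ga: "g s absolutely_integrable_on {u..v}"
      unfolding g_def
      using absolutely_integrable_continuous_bilinear[OF bounded_bilinear_mult Gc
          absolutely_integrable_scaleR_left[OF growth_rate_ln_derivative_integrable[OF \<mu>], where c = "- \<gamma>"]]
      by simp
    have "((\<lambda>r. G s r *\<^sub>R (A r ** ?E r s) + g s r *\<^sub>R ?E r s) has_integral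
        (G s v *\<^sub>R ?E v s - G s u *\<^sub>R ?E u s)) {u..v}"
    proof (rule has_integral_product_rule[OF uv locally_integrable_matrix_mult(1)[OF A Ec] ga _ _ Ec Gc])
      fix p q assume "u \<le> p" "p \<le> q" "q \<le> v"
      then show "((\<lambda>r. A r ** ?E r s) has_integral ?E q s - ?E p s) {p..q}"
        using E(1)[of s] by (simp add: solves_def)
      show "(g s has_integral G s q - G s p) {p..q}"
        using dG[of s] \<open>p \<le> q\<close>
        by (intro fundamental_theorem_of_calculus)
          (auto simp: has_real_derivative_iff_has_vector_derivative[symmetric]
            intro: has_field_derivative_at_within)
    qed
    moreover have "G s r *\<^sub>R (A r ** ?E r s) + g s r *\<^sub>R ?E r s
        = shifted \<mu> A \<gamma> r ** (G s r *\<^sub>R ?E r s)" for r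
      by (simp add: shifted_def g_def matrix_mult_scaleR
          bounded_bilinear.diff_left[OF bounded_bilinear_matrix_mult] algebra_simps)
    ultimately show "((\<lambda>r. shifted \<mu> A \<gamma> r ** (G s r *\<^sub>R ?E r s)) has_integral
        (G s v *\<^sub>R ?E v s - G s u *\<^sub>R ?E u s)) {u..v}"
      by simp
  qed
  then have "is_evolution_operator (shifted \<mu> A \<gamma>) (\<lambda>t s. G s t *\<^sub>R ?E t s)"
    by (simp add: is_evolution_operator_iff E(2) G_def)
  then have "evolution_operator (shifted \<mu> A \<gamma>) = (\<lambda>t s. G s t *\<^sub>R ?E t s)"
    by (rule evolution_operator_unique[OF locally_integrable_shifted[OF A \<mu>]
          is_evolution_operator_evolution_operator[OF locally_integrable_shifted[OF A \<mu>]]])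
  then show ?thesis
    by (simp add: G_def)
qed

section \<open>Dichotomy bounds in logarithmic form, and the translated family\<close>

lemma translate_rate_powr:
  assumes "growth_rate \<mu>"
  shows "(translate_rate \<mu> \<tau> t / translate_rate \<mu> \<tau> s) powr \<alpha>
      = exp (\<alpha> * (ln (\<mu> (t + \<tau>)) - ln (\<mu> (s + \<tau>))))"
    and "translate_rate \<mu> \<tau> s powr (sgn s * \<theta>) = exp (\<theta> * \<bar>ln (\<mu> (s + \<tau>)) - ln (\<mu> \<tau>)\<bar>)"
proof -
  have pos: "\<mu> r > 0" for r
    using assms by (simp add: growth_rate_def)
  have nz: "\<mu> r \<noteq> 0" for r
    using pos[of r] by simp
  show "(translate_rate \<mu> \<tau> t / translate_rate \<mu> \<tau> s) powr \<alpha>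
      = exp (\<alpha> * (ln (\<mu> (t + \<tau>)) - ln (\<mu> (s + \<tau>))))"
    using pos[of "t + \<tau>"] pos[of "s + \<tau>"] nz
    by (simp add: translate_rate_def powr_def ln_div)
  \<comment> \<open>Since \<open>\<mu>\<close> is strictly increasing, the sign of \<open>s\<close>
    is the sign of \<open>ln (\<mu> (s + \<tau>)) - ln (\<mu> \<tau>)\<close>, which turns the
    signed exponent into an absolute value.\<close>
  have "ln (\<mu> x) < ln (\<mu> y)" if "x < y" for x y
    using assms pos that by (simp add: growth_rate_def strict_mono_less)
  from this[of "s + \<tau>" \<tau>] this[of \<tau> "s + \<tau>"] have "sgn s * (ln (\<mu> (s + \<tau>)) - ln (\<mu> \<tau>)) = \<bar>ln (\<mu> (s + \<tau>)) - ln (\<mu> \<tau>)\<bar>"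
    by (cases s "0 :: real" rule: linorder_cases) auto
  then have "sgn s * \<theta> * (ln (\<mu> (s + \<tau>)) - ln (\<mu> \<tau>)) = \<theta> * \<bar>ln (\<mu> (s + \<tau>)) - ln (\<mu> \<tau>)\<bar>"
    by (simp only: mult.commute[of "sgn s" \<theta>] mult.assoc)
  then show "translate_rate \<mu> \<tau> s powr (sgn s * \<theta>) = exp (\<theta> * \<bar>ln (\<mu> (s + \<tau>)) - ln (\<mu> \<tau>)\<bar>)"
    using pos[of "s + \<tau>"] pos[of \<tau>] nz
    by (simp add: translate_rate_def powr_def ln_div)
qed

lemma growth_rate_powr:
  assumes "growth_rate \<mu>"
  shows "(\<mu> t / \<mu> s) powr \<alpha> = exp (\<alpha> * (ln (\<mu> t) - ln (\<mu> s)))"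
    and "\<mu> s powr (sgn s * \<theta>) = exp (\<theta> * \<bar>ln (\<mu> s)\<bar>)"
proof -
  have *: "translate_rate \<mu> 0 = \<mu>" "\<mu> 0 = 1"
    using assms by (auto simp: translate_rate_def growth_rate_def)
  show "(\<mu> t / \<mu> s) powr \<alpha> = exp (\<alpha> * (ln (\<mu> t) - ln (\<mu> s)))"
    "\<mu> s powr (sgn s * \<theta>) = exp (\<theta> * \<bar>ln (\<mu> s)\<bar>)"
    using translate_rate_powr[OF assms, of 0] by (simp_all add: *)
qed

text \<open>Applied with \<open>x = ln (\<mu> (s + \<tau>))\<close> and
  \<open>y = ln (\<mu> \<tau>)\<close>: moving the base point costs only a factor depending on
  \<open>\<tau>\<close>. The separate \<open>\<kappa>\<close> lets the estimates for
  \<open>\<theta>\<close> and \<open>\<nu>\<close> share that factor.\<close>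

lemma exp_abs_shift_le:
  fixes x y :: real
  assumes "0 \<le> K" "0 \<le> e" "0 \<le> \<eta>" "\<eta> \<le> \<kappa>"
  shows "K * e * exp (\<eta> * \<bar>x\<bar>) \<le> K * exp (\<kappa> * \<bar>y\<bar>) * e * exp (\<eta> * \<bar>x - y\<bar>)"
proof -
  have "\<eta> * \<bar>x\<bar> \<le> \<eta> * (\<bar>y\<bar> + \<bar>x - y\<bar>)"
    using assms by (intro mult_left_mono) auto
  also have "\<dots> \<le> \<kappa> * \<bar>y\<bar> + \<eta> * \<bar>x - y\<bar>"
    unfolding distrib_left using assms by (intro add_mono mult_right_mono) auto
  finally have "exp (\<eta> * \<bar>x\<bar>) \<le> exp (\<kappa> * \<bar>y\<bar>) * exp (\<eta> * \<bar>x - y\<bar>)"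
    by (simp flip: exp_add)
  then have "(K * e) * exp (\<eta> * \<bar>x\<bar>) \<le> (K * e) * (exp (\<kappa> * \<bar>y\<bar>) * exp (\<eta> * \<bar>x - y\<bar>))"
    using assms by (intro mult_left_mono) auto
  then show ?thesis
    by (simp add: mult_ac)
qed

lemma continuous_on_ln_growth_rate:
  assumes "growth_rate \<mu>"
  shows "continuous_on S (\<lambda>t. ln (\<mu> t))"
  using growth_rate_ln_derivative[OF assms] by (meson DERIV_isCont continuous_at_imp_continuous_on)

text \<open>One direction is \<open>\<tau> = 0\<close>, where
  \<open>translate_rate \<mu> 0 = \<mu>\<close>. The projector is the same on both sides, so the
  equivalence also transfers the conventions at \<open>\<plusminus>\<infinity>\<close>.\<close>

lemma nmu_dichotomy_family_iff:
  assumes \<mu>: "growth_rate \<mu>"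
  shows "nmu_dichotomy_family \<mu> B P \<longleftrightarrow> nmu_dichotomy \<mu> B P"
proof
  assume "nmu_dichotomy_family \<mu> B P"
  then obtain K \<alpha> \<beta> \<theta> \<nu> where inv: "invariant_projector B P"
    and K: "\<forall>\<tau>. K \<tau> \<ge> 1" and c: "\<alpha> < 0" "\<beta> > 0" "\<theta> \<ge> 0" "\<nu> \<ge> 0" "\<alpha> + \<theta> < 0" "\<beta> - \<nu> > 0"
    and f: "\<And>\<tau> t s. t \<ge> s \<Longrightarrow> mat_norm (translated_evolution B \<tau> t s ** P (s + \<tau>))
            \<le> K \<tau> * (translate_rate \<mu> \<tau> t / translate_rate \<mu> \<tau> s) powr \<alpha>
                  * translate_rate \<mu> \<tau> s powr (sgn s * \<theta>)"
    and b: "\<And>\<tau> t s. t \<le> s \<Longrightarrow> mat_norm (translated_evolution B \<tau> t s ** (mat 1 - P (s + \<tau>)))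
            \<le> K \<tau> * (translate_rate \<mu> \<tau> t / translate_rate \<mu> \<tau> s) powr \<beta>
                  * translate_rate \<mu> \<tau> s powr (sgn s * \<nu>)"
    unfolding nmu_dichotomy_family_def by blast
  have *: "translate_rate \<mu> 0 = \<mu>"
    using \<mu> by (auto simp: translate_rate_def growth_rate_def)
  have f0: "mat_norm (evolution_operator B t s ** P s)
            \<le> K 0 * (\<mu> t / \<mu> s) powr \<alpha> * \<mu> s powr (sgn s * \<theta>)" if "t \<ge> s" for t s
    using f[OF that, of 0] by (simp add: * translated_evolution_def)
  have b0: "mat_norm (evolution_operator B t s ** (mat 1 - P s))
            \<le> K 0 * (\<mu> t / \<mu> s) powr \<beta> * \<mu> s powr (sgn s * \<nu>)" if "t \<le> s" for t s
    using b[OF that, of 0] by (simp add: * translated_evolution_def)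
  show "nmu_dichotomy \<mu> B P"
    unfolding nmu_dichotomy_def
    by (intro conjI inv exI[of _ "K 0"] exI[of _ \<alpha>] exI[of _ \<beta>] exI[of _ \<theta>] exI[of _ \<nu>]
        K[rule_format] c allI impI f0 b0)
next
  assume "nmu_dichotomy \<mu> B P"
  then obtain K \<alpha> \<beta> \<theta> \<nu> where inv: "invariant_projector B P"
    and K: "K \<ge> 1" and c: "\<alpha> < 0" "\<beta> > 0" "\<theta> \<ge> 0" "\<nu> \<ge> 0" "\<alpha> + \<theta> < 0" "\<beta> - \<nu> > 0"
    and f: "\<And>t s. t \<ge> s \<Longrightarrow> mat_norm (evolution_operator B t s ** P s)
            \<le> K * (\<mu> t / \<mu> s) powr \<alpha> * \<mu> s powr (sgn s * \<theta>)"
    and b: "\<And>t s. t \<le> s \<Longrightarrow> mat_norm (evolution_operator B t s ** (mat 1 - P s))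
            \<le> K * (\<mu> t / \<mu> s) powr \<beta> * \<mu> s powr (sgn s * \<nu>)"
    unfolding nmu_dichotomy_def by blast
  define L where "L = (\<lambda>\<tau>. K * exp (max \<theta> \<nu> * \<bar>ln (\<mu> \<tau>)\<bar>))"
  have Lc: "continuous_on UNIV L"
    unfolding L_def by (intro continuous_on_mult_left continuous_on_exp continuous_on_rabs
        continuous_on_ln_growth_rate[OF \<mu>])
  have "1 * 1 \<le> L \<tau>" for \<tau>
    unfolding L_def using K c by (intro mult_mono) auto
  then have L1: "1 \<le> L \<tau>" for \<tau> by simp
  note key = exp_abs_shift_le[of K _ _ "max \<theta> \<nu>"]
  have fL: "mat_norm (translated_evolution B \<tau> t s ** P (s + \<tau>))
      \<le> L \<tau> * (translate_rate \<mu> \<tau> t / translate_rate \<mu> \<tau> s) powr \<alpha>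
            * translate_rate \<mu> \<tau> s powr (sgn s * \<theta>)" if "t \<ge> s" for \<tau> t s
    unfolding translated_evolution_def translate_rate_powr[OF \<mu>] L_def
    by (rule order_trans[OF f[of "s + \<tau>" "t + \<tau>", unfolded growth_rate_powr[OF \<mu>]] key])
      (use that c K in auto)
  have bL: "mat_norm (translated_evolution B \<tau> t s ** (mat 1 - P (s + \<tau>)))
      \<le> L \<tau> * (translate_rate \<mu> \<tau> t / translate_rate \<mu> \<tau> s) powr \<beta>
            * translate_rate \<mu> \<tau> s powr (sgn s * \<nu>)" if "t \<le> s" for \<tau> t s
    unfolding translated_evolution_def translate_rate_powr[OF \<mu>] L_def
    by (rule order_trans[OF b[of "t + \<tau>" "s + \<tau>", unfolded growth_rate_powr[OF \<mu>]] key])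
      (use that c K in auto)
  show "nmu_dichotomy_family \<mu> B P"
    unfolding nmu_dichotomy_family_def
    by (intro conjI inv exI[of _ L] exI[of _ \<alpha>] exI[of _ \<beta>] exI[of _ \<theta>] exI[of _ \<nu>]
        Lc L1 c allI impI fL bL)
qed

lemma nmu_spectrum_family_eq:
  "growth_rate \<mu> \<Longrightarrow> nmu_spectrum_family \<mu> A = nmu_spectrum \<mu> A"
  by (simp add: nmu_spectrum_family_def nmu_spectrum_def shifted_has_dichotomy_def
      shifted_family_has_dichotomy_def nmu_dichotomy_family_iff cong: ereal.case_cong)

lemma norm_matrix_vector_le: "norm (M *v x) \<le> mat_norm M * norm x" for M :: "real^'n^'n"
  unfolding mat_norm_def by (intro onorm matrix_vector_mul_bounded_linear)

lemma mat_norm_0: "mat_norm 0 = 0"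
  by (simp add: mat_norm_def onorm_zero)

lemma mat_norm_scaleR: "mat_norm (c *\<^sub>R M) = \<bar>c\<bar> * mat_norm M" for M :: "real^'n^'n"
  unfolding mat_norm_def scaleR_matrix_vector_assoc[symmetric]
  by (intro onorm_scaleR matrix_vector_mul_bounded_linear)

section \<open>The resolvent set and the rank of the stable space\<close>

text \<open>To be instantiated with \<open>h t = ln (\<mu> t)\<close> and the evolution operator of
  the unshifted equation. As \<open>\<gamma>\<close> is no parameter here, dichotomies for different
  shifts are compared over one and the same cocycle.\<close>

locale rate_cocycle =
  fixes h :: "real \<Rightarrow> real" and E :: "real \<Rightarrow> real \<Rightarrow> real^'n^'n"
  assumes h_mono: "mono h" and h_zero: "h 0 = 0"
    and h_top: "filterlim h at_top at_top" and h_bot: "filterlim h at_bot at_bot"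
    and E_refl: "E s s = mat 1" and E_cocycle: "E t s ** E s r = E t r"
begin

text \<open>Dichotomy of the shifted equation, expressed by the unshifted cocycle: the exponents
  \<open>a\<close>, \<open>b\<close> are \<open>\<alpha> + \<gamma>\<close>, \<open>\<beta> + \<gamma>\<close>, so that \<open>\<gamma>\<close> occurs in strict inequalities only.\<close>

definition dich :: "real \<Rightarrow> (real \<Rightarrow> real^'n^'n) \<Rightarrow> bool" where
  "dich \<gamma> P \<longleftrightarrow> (\<forall>s. P s ** P s = P s) \<and> (\<forall>t s. P t ** E t s = E t s ** P s) \<and>
     (\<exists>K a b \<theta> \<nu>. 1 \<le> K \<and> 0 \<le> \<theta> \<and> 0 \<le> \<nu> \<and> a + \<theta> < \<gamma> \<and> \<gamma> < b - \<nu> \<and>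
       (\<forall>t s. s \<le> t \<longrightarrow> mat_norm (E t s ** P s) \<le> K * exp (a * (h t - h s) + \<theta> * \<bar>h s\<bar>)) \<and>
       (\<forall>t s. t \<le> s \<longrightarrow> mat_norm (E t s ** (mat 1 - P s)) \<le> K * exp (b * (h t - h s) + \<nu> * \<bar>h s\<bar>)))"

lemma dichE:
  assumes "dich \<gamma> P"
  obtains K a b \<theta> \<nu> where "1 \<le> K" "0 \<le> \<theta>" "0 \<le> \<nu>" "a + \<theta> < \<gamma>" "\<gamma> < b - \<nu>"
    "\<And>t s. s \<le> t \<Longrightarrow> mat_norm (E t s ** P s) \<le> K * exp (a * (h t - h s) + \<theta> * \<bar>h s\<bar>)"
    "\<And>t s. t \<le> s \<Longrightarrow> mat_norm (E t s ** (mat 1 - P s)) \<le> K * exp (b * (h t - h s) + \<nu> * \<bar>h s\<bar>)"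
  using assms unfolding dich_def by blast

lemma dichI:
  assumes "\<And>s. P s ** P s = P s" "\<And>t s. P t ** E t s = E t s ** P s"
    and "1 \<le> K" "1 \<le> L" "0 \<le> \<theta>" "0 \<le> \<nu>" "a + \<theta> < \<gamma>" "\<gamma> < b - \<nu>"
    and f: "\<And>t s. s \<le> t \<Longrightarrow> mat_norm (E t s ** P s) \<le> K * exp (a * (h t - h s) + \<theta> * \<bar>h s\<bar>)"
    and b: "\<And>t s. t \<le> s \<Longrightarrow> mat_norm (E t s ** (mat 1 - P s)) \<le> L * exp (b * (h t - h s) + \<nu> * \<bar>h s\<bar>)"
  shows "dich \<gamma> P"
proof -
  have "mat_norm (E t s ** P s) \<le> max K L * exp (a * (h t - h s) + \<theta> * \<bar>h s\<bar>)" if "s \<le> t" for t s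
    by (rule order_trans[OF f[OF that]]) (simp add: mult_right_mono)
  moreover have "mat_norm (E t s ** (mat 1 - P s)) \<le> max K L * exp (b * (h t - h s) + \<nu> * \<bar>h s\<bar>)"
    if "t \<le> s" for t s
    by (rule order_trans[OF b[OF that]]) (simp add: mult_right_mono)
  moreover have "1 \<le> max K L"
    using assms by simp
  ultimately show ?thesis
    unfolding dich_def using assms(1-8) by blast
qed

section \<open>Dichotomies with a fixed projector\<close>

lemma dich_projection: "dich \<gamma> P \<Longrightarrow> P s ** P s = P s"
  and dich_invariant: "dich \<gamma> P \<Longrightarrow> P t ** E t s = E t s ** P s"
  by (auto simp: dich_def)

text \<open>The common projector allows the forward estimate to be taken from the lower shift and
  the backward estimate from the upper one: \<open>a + \<theta> < \<gamma> \<le> \<eta>\<close> and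
  \<open>\<eta> \<le> \<gamma>' < b - \<nu>\<close>.\<close>

lemma dich_between:
  assumes "dich \<gamma> P" "dich \<gamma>' P" "\<gamma> \<le> \<eta>" "\<eta> \<le> \<gamma>'"
  shows "dich \<eta> P"
proof -
  obtain K a \<theta> where 1: "1 \<le> K" "0 \<le> \<theta>" "a + \<theta> < \<gamma>"
    "\<And>t s. s \<le> t \<Longrightarrow> mat_norm (E t s ** P s) \<le> K * exp (a * (h t - h s) + \<theta> * \<bar>h s\<bar>)"
    using dichE[OF assms(1)] by metis
  obtain L b \<nu> where 2: "1 \<le> L" "0 \<le> \<nu>" "\<gamma>' < b - \<nu>"
    "\<And>t s. t \<le> s \<Longrightarrow> mat_norm (E t s ** (mat 1 - P s)) \<le> L * exp (b * (h t - h s) + \<nu> * \<bar>h s\<bar>)"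
    using dichE[OF assms(2)] by metis
  show ?thesis
    using dich_projection[OF assms(1)] dich_invariant[OF assms(1)] 1 2 assms(3,4)
    by (intro dichI[of P K L \<theta> \<nu> a \<eta> b]) auto
qed

text \<open>The estimates do not mention \<open>\<gamma>\<close>, so the whole open interval from
  \<open>a + \<theta>\<close> to \<open>b - \<nu>\<close> shares them.\<close>

lemma dich_nhd:
  assumes "dich \<gamma> P"
  obtains l u where "l < \<gamma>" "\<gamma> < u" "\<And>\<eta>. l < \<eta> \<Longrightarrow> \<eta> < u \<Longrightarrow> dich \<eta> P"
proof -
  obtain K a b \<theta> \<nu> where 1: "1 \<le> K" "0 \<le> \<theta>" "0 \<le> \<nu>" "a + \<theta> < \<gamma>" "\<gamma> < b - \<nu>"
    "\<And>t s. s \<le> t \<Longrightarrow> mat_norm (E t s ** P s) \<le> K * exp (a * (h t - h s) + \<theta> * \<bar>h s\<bar>)"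
    "\<And>t s. t \<le> s \<Longrightarrow> mat_norm (E t s ** (mat 1 - P s)) \<le> K * exp (b * (h t - h s) + \<nu> * \<bar>h s\<bar>)"
    using assms by (rule dichE) metis
  have "dich \<eta> P" if "a + \<theta> < \<eta>" "\<eta> < b - \<nu>" for \<eta>
    using dich_projection[OF assms(1)] dich_invariant[OF assms(1)] 1 that
    by (intro dichI[of P K K \<theta> \<nu> a \<eta> b]) auto
  with 1 show ?thesis by (intro that[of "a + \<theta>" "b - \<nu>"]) auto
qed

lemma matrix_mult_zero: "X ** (0 :: real^'n^'n) = 0" "(0 :: real^'n^'n) ** X = 0" for X :: "real^'n^'n"
  by (rule bounded_bilinear.zero_right[OF bounded_bilinear_matrix_mult],
      rule bounded_bilinear.zero_left[OF bounded_bilinear_matrix_mult])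

text \<open>With the identity as projector the complementary part is zero, so with
  \<open>\<nu> = 0\<close> any \<open>b\<close> above \<open>\<gamma>\<close> will do, and
  \<open>\<gamma>\<close> stays bounded from below only.\<close>

lemma dich_id_iff:
  "dich \<gamma> (\<lambda>_. mat 1) \<longleftrightarrow> (\<exists>K a \<theta>. 1 \<le> K \<and> 0 \<le> \<theta> \<and> a + \<theta> < \<gamma> \<and>
     (\<forall>t s. s \<le> t \<longrightarrow> mat_norm (E t s) \<le> K * exp (a * (h t - h s) + \<theta> * \<bar>h s\<bar>)))"
    (is "_ \<longleftrightarrow> ?R")
proof
  show ?R if "dich \<gamma> (\<lambda>_. mat 1)"
    using dichE[OF that] by (metis matrix_mul_rid)
next
  assume ?R
  then obtain K a \<theta> where "1 \<le> K" "0 \<le> \<theta>" "a + \<theta> < \<gamma>"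
    "\<And>t s. s \<le> t \<Longrightarrow> mat_norm (E t s) \<le> K * exp (a * (h t - h s) + \<theta> * \<bar>h s\<bar>)"
    by blast
  then show "dich \<gamma> (\<lambda>_. mat 1)"
    by (intro dichI[of _ K 1 \<theta> 0 a \<gamma> "\<gamma> + 1"]) (auto simp: matrix_mult_zero mat_norm_0)
qed

text \<open>Mirror image of \<open>dich_id_iff\<close>: the forward estimate is void and
  \<open>\<gamma>\<close> stays bounded from above only.\<close>

lemma dich_zero_iff:
  "dich \<gamma> (\<lambda>_. 0) \<longleftrightarrow> (\<exists>K b \<nu>. 1 \<le> K \<and> 0 \<le> \<nu> \<and> \<gamma> < b - \<nu> \<and>
     (\<forall>t s. t \<le> s \<longrightarrow> mat_norm (E t s) \<le> K * exp (b * (h t - h s) + \<nu> * \<bar>h s\<bar>)))"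
    (is "_ \<longleftrightarrow> ?R")
proof
  show ?R if "dich \<gamma> (\<lambda>_. 0)"
    using dichE[OF that] by (metis diff_zero matrix_mul_rid)
next
  assume ?R
  then obtain K b \<nu> where "1 \<le> K" "0 \<le> \<nu>" "\<gamma> < b - \<nu>"
    "\<And>t s. t \<le> s \<Longrightarrow> mat_norm (E t s) \<le> K * exp (b * (h t - h s) + \<nu> * \<bar>h s\<bar>)"
    by blast
  then show "dich \<gamma> (\<lambda>_. 0)"
    by (intro dichI[of _ 1 K 0 \<nu> "\<gamma> - 1" \<gamma> b]) (auto simp: matrix_mult_zero mat_norm_0)
qed

lemma dich_id_mono: "dich \<gamma> (\<lambda>_. mat 1) \<Longrightarrow> \<gamma> \<le> \<gamma>' \<Longrightarrow> dich \<gamma>' (\<lambda>_. mat 1)"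
  unfolding dich_id_iff by (meson less_le_trans)

lemma dich_zero_antimono: "dich \<gamma> (\<lambda>_. 0) \<Longrightarrow> \<gamma>' \<le> \<gamma> \<Longrightarrow> dich \<gamma>' (\<lambda>_. 0)"
  unfolding dich_zero_iff by (meson le_less_trans)

section \<open>Bounded growth\<close>

definition bounded_growth :: bool where
  "bounded_growth \<longleftrightarrow> (\<exists>L a \<epsilon>. 1 \<le> L \<and> 0 < a \<and> 0 \<le> \<epsilon> \<and>
     (\<forall>t s. mat_norm (E t s) \<le> L * exp (a * \<bar>h t - h s\<bar> + \<epsilon> * \<bar>h s\<bar>)))"

lemma h_le: "s \<le> t \<Longrightarrow> h s \<le> h t"
  using h_mono by (rule monoD)

text \<open>For \<open>s \<le> t\<close> the growth bound is the forward estimate of a dichotomy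
  with identity projector, for \<open>t \<le> s\<close> the backward estimate of one with zero
  projector. Conversely, these two one-sided bounds cover all pairs of times.\<close>

lemma bounded_growth_iff:
  "bounded_growth \<longleftrightarrow> (\<exists>\<gamma>. dich \<gamma> (\<lambda>_. mat 1)) \<and> (\<exists>\<gamma>. dich \<gamma> (\<lambda>_. 0))"
proof
  assume bounded_growth
  then obtain L a \<epsilon> where L: "1 \<le> L" "0 < a" "0 \<le> \<epsilon>"
    "\<And>t s. mat_norm (E t s) \<le> L * exp (a * \<bar>h t - h s\<bar> + \<epsilon> * \<bar>h s\<bar>)"
    unfolding bounded_growth_def by blast
  have "mat_norm (E t s) \<le> L * exp (a * (h t - h s) + \<epsilon> * \<bar>h s\<bar>)" if "s \<le> t" for t s
    using L(4)[of t s] h_le[OF that] by simp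
  then have "dich (a + \<epsilon> + 1) (\<lambda>_. mat 1)"
    unfolding dich_id_iff using L(1-3) by (intro exI[of _ L] exI[of _ a] exI[of _ \<epsilon>]) auto
  moreover have "mat_norm (E t s) \<le> L * exp ((- a) * (h t - h s) + \<epsilon> * \<bar>h s\<bar>)" if "t \<le> s" for t s
    using L(4)[of t s] h_le[OF that] by (simp add: algebra_simps)
  then have "dich (- a - \<epsilon> - 1) (\<lambda>_. 0)"
    unfolding dich_zero_iff using L(1-3) by (intro exI[of _ L] exI[of _ "- a"] exI[of _ \<epsilon>]) auto
  ultimately show "(\<exists>\<gamma>. dich \<gamma> (\<lambda>_. mat 1)) \<and> (\<exists>\<gamma>. dich \<gamma> (\<lambda>_. 0))" by blast
next
  assume "(\<exists>\<gamma>. dich \<gamma> (\<lambda>_. mat 1)) \<and> (\<exists>\<gamma>. dich \<gamma> (\<lambda>_. 0))"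
  then obtain \<gamma> \<gamma>' where "dich \<gamma> (\<lambda>_. mat 1)" "dich \<gamma>' (\<lambda>_. 0)" by blast
  then obtain K a \<theta> L b \<nu> where K: "1 \<le> K" "0 \<le> \<theta>"
    "\<And>t s. s \<le> t \<Longrightarrow> mat_norm (E t s) \<le> K * exp (a * (h t - h s) + \<theta> * \<bar>h s\<bar>)"
    and L: "1 \<le> L" "0 \<le> \<nu>"
    "\<And>t s. t \<le> s \<Longrightarrow> mat_norm (E t s) \<le> L * exp (b * (h t - h s) + \<nu> * \<bar>h s\<bar>)"
    unfolding dich_id_iff dich_zero_iff by blast
  \<comment> \<open>The 1 secures a positive rate; the absolute values account for \<open>a\<close>
    and \<open>b\<close> of either sign.\<close>
  define c where "c = max 1 (max \<bar>a\<bar> \<bar>b\<bar>)"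
  have gen: "M * exp (d * (h t - h s) + \<eta> * \<bar>h s\<bar>) \<le> max K L * exp (c * \<bar>h t - h s\<bar> + max \<theta> \<nu> * \<bar>h s\<bar>)"
    if "1 \<le> M" "M \<le> max K L" "\<bar>d\<bar> \<le> c" "\<eta> \<le> max \<theta> \<nu>" for M d \<eta> t s
  proof -
    have "d * (h t - h s) \<le> \<bar>d\<bar> * \<bar>h t - h s\<bar>"
      by (metis abs_ge_self abs_mult)
    also have "\<dots> \<le> c * \<bar>h t - h s\<bar>"
      using that by (intro mult_right_mono) auto
    finally show ?thesis
      using that by (intro mult_mono) (auto intro!: add_mono mult_right_mono)
  qed
  have "mat_norm (E t s) \<le> max K L * exp (c * \<bar>h t - h s\<bar> + max \<theta> \<nu> * \<bar>h s\<bar>)" for t s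
  proof (cases "s \<le> t")
    case True
    show ?thesis
      by (rule order_trans[OF K(3)[OF True] gen]) (use K in \<open>auto simp: c_def\<close>)
  next
    case False
    then have "t \<le> s" by simp
    show ?thesis
      by (rule order_trans[OF L(3)[OF \<open>t \<le> s\<close>] gen]) (use L in \<open>auto simp: c_def\<close>)
  qed
  then show bounded_growth
    unfolding bounded_growth_def using K L
    by (intro exI[of _ "max K L"] exI[of _ c] exI[of _ "max \<theta> \<nu>"]) (auto simp: c_def)
qed

section \<open>Stable and unstable spaces at time 0\<close>

definition stable :: "real \<Rightarrow> (real^'n) set" where
  "stable \<gamma> = {\<xi>. \<exists>C. \<forall>t\<ge>0. norm (E t 0 *v \<xi>) \<le> C * exp (\<gamma> * h t)}"

definition unstable :: "real \<Rightarrow> (real^'n) set" where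
  "unstable \<gamma> = {\<xi>. \<exists>C. \<forall>t\<le>0. norm (E t 0 *v \<xi>) \<le> C * exp (\<gamma> * h t)}"

lemma h_nonneg: "0 \<le> t \<Longrightarrow> 0 \<le> h t" and h_nonpos: "t \<le> 0 \<Longrightarrow> h t \<le> 0"
  using h_le[of 0 t] h_le[of t 0] h_zero by auto

lemma stable_mono: "\<gamma> \<le> \<gamma>' \<Longrightarrow> stable \<gamma> \<subseteq> stable \<gamma>'"
proof
  fix \<xi> assume le: "\<gamma> \<le> \<gamma>'" and "\<xi> \<in> stable \<gamma>"
  then obtain C where C: "norm (E t 0 *v \<xi>) \<le> C * exp (\<gamma> * h t)" if "0 \<le> t" for t
    by (auto simp: stable_def)
  have "0 \<le> C"
    using order_trans[OF norm_ge_zero C[of 0]] by (simp add: zero_le_mult_iff)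
  have "norm (E t 0 *v \<xi>) \<le> C * exp (\<gamma>' * h t)" if "0 \<le> t" for t
    by (rule order_trans[OF C[OF that]])
      (use le h_nonneg[OF that] \<open>0 \<le> C\<close> in \<open>auto intro!: mult_left_mono mult_right_mono\<close>)
  then show "\<xi> \<in> stable \<gamma>'" by (auto simp: stable_def)
qed

lemma unstable_antimono: "\<gamma> \<le> \<gamma>' \<Longrightarrow> unstable \<gamma>' \<subseteq> unstable \<gamma>"
proof
  fix \<xi> assume le: "\<gamma> \<le> \<gamma>'" and "\<xi> \<in> unstable \<gamma>'"
  then obtain C where C: "norm (E t 0 *v \<xi>) \<le> C * exp (\<gamma>' * h t)" if "t \<le> 0" for t
    by (auto simp: unstable_def)
  have "0 \<le> C"
    using order_trans[OF norm_ge_zero C[of 0]] by (simp add: zero_le_mult_iff)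
  have "norm (E t 0 *v \<xi>) \<le> C * exp (\<gamma> * h t)" if "t \<le> 0" for t
    by (rule order_trans[OF C[OF that]])
      (use le h_nonpos[OF that] \<open>0 \<le> C\<close> in \<open>auto intro!: mult_left_mono mult_right_mono_neg\<close>)
  then show "\<xi> \<in> unstable \<gamma>" by (auto simp: unstable_def)
qed

lemma subspace_stable: "subspace (stable \<gamma>)"
  unfolding subspace_def
proof (intro conjI ballI allI)
  show "0 \<in> stable \<gamma>"
    by (auto simp: stable_def intro!: exI[of _ 0])
  fix x y :: "real^'n" and c :: real
  assume "x \<in> stable \<gamma>"
  then obtain C where C: "norm (E t 0 *v x) \<le> C * exp (\<gamma> * h t)" if "0 \<le> t" for t
    by (auto simp: stable_def)
  have "norm (E t 0 *v (c *\<^sub>R x)) \<le> (\<bar>c\<bar> * C) * exp (\<gamma> * h t)" if "0 \<le> t" for t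
    using mult_left_mono[OF C[OF that], of "\<bar>c\<bar>"]
    by (simp add: matrix_vector_mult_scaleR mult.assoc)
  then show "c *\<^sub>R x \<in> stable \<gamma>" by (auto simp: stable_def)
  assume "y \<in> stable \<gamma>"
  then obtain D where D: "norm (E t 0 *v y) \<le> D * exp (\<gamma> * h t)" if "0 \<le> t" for t
    by (auto simp: stable_def)
  have "norm (E t 0 *v (x + y)) \<le> (C + D) * exp (\<gamma> * h t)" if "0 \<le> t" for t
    unfolding matrix_vector_right_distrib distrib_right
    using C[OF that] D[OF that] by (rule norm_triangle_mono)
  then show "x + y \<in> stable \<gamma>" by (auto simp: stable_def)
qed

text \<open>A vector of either space is transported to time \<open>t\<close>, projected to the complementary
  bundle and transported back; letting \<open>t \<rightarrow> \<plusminus>\<infinity>\<close> annihilates its complementary component.\<close>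

lemma stable_eq:
  assumes "dich \<gamma> P"
  shows "stable \<gamma> = {\<xi>. P 0 *v \<xi> = \<xi>}"
proof -
  obtain K a b \<theta> \<nu> where K: "1 \<le> K" "0 \<le> \<theta>" "0 \<le> \<nu>" "a + \<theta> < \<gamma>" "\<gamma> < b - \<nu>"
    and f: "\<And>t s. s \<le> t \<Longrightarrow> mat_norm (E t s ** P s) \<le> K * exp (a * (h t - h s) + \<theta> * \<bar>h s\<bar>)"
    and b: "\<And>t s. t \<le> s \<Longrightarrow> mat_norm (E t s ** (mat 1 - P s)) \<le> K * exp (b * (h t - h s) + \<nu> * \<bar>h s\<bar>)"
    using assms by (rule dichE) metis
  show ?thesis
  proof (intro equalityI subsetI CollectI; (elim CollectE)?)
    fix \<xi> assume \<xi>: "P 0 *v \<xi> = \<xi>"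
    have "norm (E t 0 *v \<xi>) \<le> (K * norm \<xi>) * exp (\<gamma> * h t)" if "0 \<le> t" for t
    proof -
      have "norm (E t 0 *v \<xi>) = norm ((E t 0 ** P 0) *v \<xi>)"
        by (simp add: \<xi> flip: matrix_vector_mul_assoc)
      also have "\<dots> \<le> (K * exp (a * (h t - h 0) + \<theta> * \<bar>h 0\<bar>)) * norm \<xi>"
        by (rule order_trans[OF norm_matrix_vector_le]) (intro mult_right_mono f that norm_ge_zero)
      also have "\<dots> = (K * norm \<xi>) * exp (a * h t)"
        by (simp add: h_zero)
      also have "\<dots> \<le> (K * norm \<xi>) * exp (\<gamma> * h t)"
        using K h_nonneg[OF that] by (intro mult_left_mono) (auto intro!: mult_right_mono)
      finally show ?thesis .
    qed
    then show "\<xi> \<in> stable \<gamma>" by (auto simp: stable_def)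
  next
    fix \<xi> assume "\<xi> \<in> stable \<gamma>"
    then obtain C where C: "norm (E t 0 *v \<xi>) \<le> C * exp (\<gamma> * h t)" if "0 \<le> t" for t
      by (auto simp: stable_def)
    define \<eta> where "\<eta> = \<xi> - P 0 *v \<xi>"
    \<comment> \<open>The orbit contributes the rate \<open>\<gamma>\<close>, the return to time 0
      contributes \<open>- b\<close>, and the nonuniform factor contributes \<open>\<nu>\<close>
      because \<open>h t \<ge> 0\<close>. The total is negative by
      \<open>\<gamma> < b - \<nu>\<close>.\<close>
    have bound: "norm \<eta> \<le> (K * C) * exp (- ((b - \<nu> - \<gamma>) * h t))" if "0 \<le> t" for t
    proof -
      have "(E 0 t ** (mat 1 - P t)) ** E t 0 = E 0 t ** (E t 0 - P t ** E t 0)"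
        by (simp add: bounded_bilinear.diff_left[OF bounded_bilinear_matrix_mult] flip: matrix_mul_assoc)
      also have "\<dots> = mat 1 - P 0"
        by (simp add: dich_invariant[OF assms] bounded_bilinear.diff_right[OF bounded_bilinear_matrix_mult]
            matrix_mul_assoc E_cocycle E_refl)
      finally have "\<eta> = (E 0 t ** (mat 1 - P t)) *v (E t 0 *v \<xi>)"
        by (simp add: \<eta>_def matrix_vector_mul_assoc matrix_vector_mult_diff_rdistrib)
      also have "norm \<dots> \<le> (K * exp (b * (h 0 - h t) + \<nu> * \<bar>h t\<bar>)) * (C * exp (\<gamma> * h t))"
        by (rule order_trans[OF norm_matrix_vector_le])
          (use K in \<open>intro mult_mono b C that norm_ge_zero mult_nonneg_nonneg, auto\<close>)
      also have "\<dots> = (K * C) * exp ((b * (h 0 - h t) + \<nu> * \<bar>h t\<bar>) + \<gamma> * h t)"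
        unfolding exp_add by simp
      also have "(b * (h 0 - h t) + \<nu> * \<bar>h t\<bar>) + \<gamma> * h t = - ((b - \<nu> - \<gamma>) * h t)"
        using h_nonneg[OF that] by (simp add: h_zero algebra_simps)
      finally show ?thesis .
    qed
    have "filterlim (\<lambda>t. (b - \<nu> - \<gamma>) * h t) at_top at_top"
      using K by (intro filterlim_tendsto_pos_mult_at_top[OF tendsto_const _ h_top]) auto
    then have "((\<lambda>t. (K * C) * exp (- ((b - \<nu> - \<gamma>) * h t))) \<longlongrightarrow> (K * C) * 0) at_top"
      by (intro tendsto_mult tendsto_const filterlim_compose[OF exp_at_bot])
        (simp add: filterlim_uminus_at_bot)
    then have "norm \<eta> \<le> (K * C) * 0"
      using bound by (intro tendsto_lowerbound[of _ _ at_top])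
        (auto intro!: eventually_at_top_linorderI[of 0])
    then show "P 0 *v \<xi> = \<xi>" by (simp add: \<eta>_def)
  qed
qed

lemma unstable_eq:
  assumes "dich \<gamma> P"
  shows "unstable \<gamma> = {\<xi>. P 0 *v \<xi> = 0}"
proof -
  obtain K a b \<theta> \<nu> where K: "1 \<le> K" "0 \<le> \<theta>" "0 \<le> \<nu>" "a + \<theta> < \<gamma>" "\<gamma> < b - \<nu>"
    and f: "\<And>t s. s \<le> t \<Longrightarrow> mat_norm (E t s ** P s) \<le> K * exp (a * (h t - h s) + \<theta> * \<bar>h s\<bar>)"
    and b: "\<And>t s. t \<le> s \<Longrightarrow> mat_norm (E t s ** (mat 1 - P s)) \<le> K * exp (b * (h t - h s) + \<nu> * \<bar>h s\<bar>)"
    using assms by (rule dichE) metis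
  show ?thesis
  proof (intro equalityI subsetI CollectI; (elim CollectE)?)
    fix \<xi> assume \<xi>: "P 0 *v \<xi> = 0"
    have "norm (E t 0 *v \<xi>) \<le> (K * norm \<xi>) * exp (\<gamma> * h t)" if "t \<le> 0" for t
    proof -
      have "norm (E t 0 *v \<xi>) = norm ((E t 0 ** (mat 1 - P 0)) *v \<xi>)"
        by (simp add: \<xi> matrix_vector_mult_diff_rdistrib flip: matrix_vector_mul_assoc)
      also have "\<dots> \<le> (K * exp (b * (h t - h 0) + \<nu> * \<bar>h 0\<bar>)) * norm \<xi>"
        by (rule order_trans[OF norm_matrix_vector_le]) (intro mult_right_mono b that norm_ge_zero)
      also have "\<dots> = (K * norm \<xi>) * exp (b * h t)"
        by (simp add: h_zero)
      also have "\<dots> \<le> (K * norm \<xi>) * exp (\<gamma> * h t)"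
        using K h_nonpos[OF that] by (intro mult_left_mono) (auto intro!: mult_right_mono_neg)
      finally show ?thesis .
    qed
    then show "\<xi> \<in> unstable \<gamma>" by (auto simp: unstable_def)
  next
    fix \<xi> assume "\<xi> \<in> unstable \<gamma>"
    then obtain C where C: "norm (E t 0 *v \<xi>) \<le> C * exp (\<gamma> * h t)" if "t \<le> 0" for t
      by (auto simp: unstable_def)
    \<comment> \<open>Here \<open>\<bar>h t\<bar> = - h t\<close>, so the nonuniform factor
      contributes \<open>- \<theta>\<close>; as \<open>h t\<close> tends to minus infinity,
      \<open>a + \<theta> < \<gamma>\<close> makes the bound vanish.\<close>
    have bound: "norm (P 0 *v \<xi>) \<le> (K * C) * exp ((\<gamma> - a - \<theta>) * h t)" if "t \<le> 0" for t
    proof -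
      have "(E 0 t ** P t) ** E t 0 = P 0"
        by (simp add: dich_invariant[OF assms, symmetric] E_cocycle E_refl flip: matrix_mul_assoc)
      then have "P 0 *v \<xi> = (E 0 t ** P t) *v (E t 0 *v \<xi>)"
        by (simp add: matrix_vector_mul_assoc)
      also have "norm \<dots> \<le> (K * exp (a * (h 0 - h t) + \<theta> * \<bar>h t\<bar>)) * (C * exp (\<gamma> * h t))"
        by (rule order_trans[OF norm_matrix_vector_le])
          (use K in \<open>intro mult_mono f C that norm_ge_zero mult_nonneg_nonneg, auto\<close>)
      also have "\<dots> = (K * C) * exp ((a * (h 0 - h t) + \<theta> * \<bar>h t\<bar>) + \<gamma> * h t)"
        unfolding exp_add by simp
      also have "(a * (h 0 - h t) + \<theta> * \<bar>h t\<bar>) + \<gamma> * h t = (\<gamma> - a - \<theta>) * h t"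
        using h_nonpos[OF that] by (simp add: h_zero algebra_simps)
      finally show ?thesis .
    qed
    have "filterlim (\<lambda>t. (\<gamma> - a - \<theta>) * h t) at_bot at_bot"
      using K by (intro filterlim_tendsto_pos_mult_at_bot[OF tendsto_const _ h_bot]) auto
    then have "((\<lambda>t. (K * C) * exp ((\<gamma> - a - \<theta>) * h t)) \<longlongrightarrow> (K * C) * 0) at_bot"
      by (intro tendsto_mult tendsto_const filterlim_compose[OF exp_at_bot])
    then have "norm (P 0 *v \<xi>) \<le> (K * C) * 0"
      using bound by (intro tendsto_lowerbound[of _ _ at_bot])
        (auto intro!: eventually_at_bot_linorderI[of 0])
    then show "P 0 *v \<xi> = 0" by simp
  qed
qed

section \<open>Recovering the projector from the stable space\<close>

lemma dich_projector_determined: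
  assumes "dich \<gamma> P"
  shows "P t = E t 0 ** P 0 ** E 0 t"
  using dich_invariant[OF assms, of t 0, symmetric]
  by (simp add: E_cocycle E_refl flip: matrix_mul_assoc)

text \<open>The ranges at time 0 are the stable spaces, hence equal. The kernel of
  \<open>P' 0\<close> is \<open>unstable \<gamma>'\<close>, contained in
  \<open>unstable \<gamma>\<close>, the kernel of \<open>P 0\<close>. Projections with equal ranges
  and nested kernels coincide, and invariance extends this to all times.\<close>

lemma dich_projector_unique:
  assumes "dich \<gamma> P" "dich \<gamma>' P'" "\<gamma> \<le> \<gamma>'" "stable \<gamma> = stable \<gamma>'"
  shows "P = P'"
proof -
  have "P 0 *v \<xi> = P' 0 *v \<xi>" for \<xi>
  proof -
    have proj: "P' 0 *v (P' 0 *v \<xi>) = P' 0 *v \<xi>"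
      by (simp add: matrix_vector_mul_assoc dich_projection[OF assms(2)])
    then have "P' 0 *v \<xi> \<in> stable \<gamma>"
      unfolding assms(4) stable_eq[OF assms(2)] by simp
    then have 1: "P 0 *v (P' 0 *v \<xi>) = P' 0 *v \<xi>"
      by (simp add: stable_eq[OF assms(1)])
    have "\<xi> - P' 0 *v \<xi> \<in> unstable \<gamma>'"
      using proj by (simp add: unstable_eq[OF assms(2)] matrix_vector_mult_diff_distrib)
    then have "\<xi> - P' 0 *v \<xi> \<in> unstable \<gamma>"
      using unstable_antimono[OF assms(3)] by blast
    then have "P 0 *v \<xi> = P 0 *v (P' 0 *v \<xi>)"
      by (simp add: unstable_eq[OF assms(1)] matrix_vector_mult_diff_distrib)
    then show ?thesis using 1 by simp
  qed
  then have eq: "P 0 = P' 0"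
    by (simp add: matrix_eq)
  show ?thesis
  proof
    show "P t = P' t" for t
      using dich_projector_determined[OF assms(1), of t] dich_projector_determined[OF assms(2), of t]
      by (simp add: eq)
  qed
qed

lemma stable_eq_if_dim_eq:
  assumes "\<gamma> \<le> \<gamma>'" "dim (stable \<gamma>) = dim (stable \<gamma>')"
  shows "stable \<gamma> = stable \<gamma>'"
  using subspace_dim_equal[OF subspace_stable subspace_stable stable_mono[OF assms(1)]] assms(2)
  by simp

text \<open>Every vector is then fixed by \<open>P 0\<close>, and transport by the cocycle carries
  the identity to every time.\<close>

lemma dich_full_rank:
  assumes "dich \<gamma> P" "dim (stable \<gamma>) = CARD('n)"
  shows "dich \<gamma> (\<lambda>_. mat 1)"
proof -
  have "stable \<gamma> = UNIV"
    using assms(2) subspace_stable[of \<gamma>] by (metis dim_eq_full DIM_cart DIM_real mult.right_neutral span_eq_iff)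
  then have "P 0 = mat 1"
    using stable_eq[OF assms(1)] by (auto simp: matrix_eq)
  then have "P t = mat 1" for t
    using dich_projector_determined[OF assms(1), of t] by (simp add: E_cocycle E_refl)
  then have "P = (\<lambda>_. mat 1)" by (rule ext)
  then show ?thesis using assms(1) by simp
qed

lemma dich_zero_rank:
  assumes "dich \<gamma> P" "dim (stable \<gamma>) = 0"
  shows "dich \<gamma> (\<lambda>_. 0)"
proof -
  have "P 0 *v \<xi> \<in> stable \<gamma>" for \<xi>
    by (simp add: stable_eq[OF assms(1)] matrix_vector_mul_assoc dich_projection[OF assms(1)])
  then have "P 0 = 0"
    using assms(2) by (auto simp: matrix_eq dim_eq_0)
  then have "P t = 0" for t
    using dich_projector_determined[OF assms(1), of t] by (simp add: matrix_mult_zero)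
  then have "P = (\<lambda>_. 0)" by (rule ext)
  then show ?thesis using assms(1) by simp
qed

section \<open>The resolvent set in the extended reals and its rank function\<close>

definition resolvent :: "ereal set" where
  "resolvent = {x. case x of ereal g \<Rightarrow> (\<exists>P. dich g P)
     | PInfty \<Rightarrow> (\<exists>g. dich g (\<lambda>_. mat 1)) | MInfty \<Rightarrow> (\<exists>g. dich g (\<lambda>_. 0))}"

text \<open>The values at the infinities are the ranks of the projectors that the convention
  prescribes there. Real points outside the resolvent set also receive the dimension of
  \<open>stable\<close>, which makes the rank monotone on the whole extended line.\<close>

definition stable_rank :: "ereal \<Rightarrow> nat" where
  "stable_rank x = (case x of ereal g \<Rightarrow> dim (stable g) | PInfty \<Rightarrow> CARD('n) | MInfty \<Rightarrow> 0)"

lemma resolvent_simps: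
  "ereal g \<in> resolvent \<longleftrightarrow> (\<exists>P. dich g P)"
  "\<infinity> \<in> resolvent \<longleftrightarrow> (\<exists>g. dich g (\<lambda>_. mat 1))"
  "- \<infinity> \<in> resolvent \<longleftrightarrow> (\<exists>g. dich g (\<lambda>_. 0))"
  by (simp_all add: resolvent_def)

lemma stable_rank_simps:
  "stable_rank (ereal g) = dim (stable g)" "stable_rank \<infinity> = CARD('n)" "stable_rank (- \<infinity>) = 0"
  by (simp_all add: stable_rank_def)

lemma stable_rank_le: "stable_rank x \<le> CARD('n)"
  using dim_subset_UNIV[of "stable (real_of_ereal x)"]
  by (cases x) (auto simp: stable_rank_simps dim_subset_UNIV_cart)

lemma stable_rank_mono: "x \<le> y \<Longrightarrow> stable_rank x \<le> stable_rank y"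
  using stable_rank_le[of x]
  by (cases x; cases y) (auto simp: stable_rank_simps intro!: dim_subset[OF stable_mono])

lemma dim_stable_id: "dich \<gamma> (\<lambda>_. mat 1) \<Longrightarrow> dim (stable \<gamma>) = CARD('n)"
  by (simp add: stable_eq)

lemma dim_stable_zero: "dich \<gamma> (\<lambda>_. 0) \<Longrightarrow> dim (stable \<gamma>) = 0"
  by (simp add: stable_eq)

lemma infinity_in_resolvent:
  assumes "x \<in> resolvent" "stable_rank x = CARD('n)"
  shows "\<infinity> \<in> resolvent"
proof (cases x)
  case (real g)
  then obtain P where "dich g P" "dim (stable g) = CARD('n)"
    using assms by (auto simp: resolvent_simps stable_rank_simps)
  then have "dich g (\<lambda>_. mat 1)" by (rule dich_full_rank)
  then show ?thesis unfolding resolvent_simps by (rule exI)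
qed (use assms in \<open>auto simp: stable_rank_simps\<close>)

lemma minus_infinity_in_resolvent:
  assumes "x \<in> resolvent" "stable_rank x = 0"
  shows "- \<infinity> \<in> resolvent"
proof (cases x)
  case (real g)
  then obtain P where "dich g P" "dim (stable g) = 0"
    using assms by (auto simp: resolvent_simps stable_rank_simps)
  then have "dich g (\<lambda>_. 0)" by (rule dich_zero_rank)
  then show ?thesis unfolding resolvent_simps by (rule exI)
qed (use assms in \<open>auto simp: stable_rank_simps\<close>)

text \<open>Near a real point the same projector keeps working; near an infinity, the shift
  witnessing its membership opens a half-line on which the identity or the zero projector
  works.\<close>

lemma resolvent_open:
  assumes "x \<in> resolvent"
  shows "\<exists>V. open V \<and> x \<in> V \<and> (\<forall>y\<in>V. y \<in> resolvent \<and> stable_rank y = stable_rank x)"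
proof (cases x)
  case (real g)
  then obtain P where P: "dich g P"
    using assms by (auto simp: resolvent_simps)
  obtain l u where lu: "l < g" "g < u" "\<And>\<eta>. l < \<eta> \<Longrightarrow> \<eta> < u \<Longrightarrow> dich \<eta> P"
    using dich_nhd[OF P] by blast
  have *: "y \<in> resolvent \<and> stable_rank y = stable_rank x" if y: "y \<in> {ereal l<..<ereal u}" for y
  proof -
    obtain \<eta> where \<eta>: "y = ereal \<eta>" "l < \<eta>" "\<eta> < u"
      using y by (cases y) auto
    then have "dich \<eta> P" using lu by simp
    then show ?thesis
      using \<eta>(1) stable_eq[OF P] stable_eq[OF \<open>dich \<eta> P\<close>] real
      by (auto simp: resolvent_simps stable_rank_simps)
  qed
  show ?thesis
    by (intro exI[of _ "{ereal l<..<ereal u}"] conjI ballI * open_greaterThanLessThan)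
      (simp_all add: real lu(1,2))
next
  case PInf
  then obtain g where g: "dich g (\<lambda>_. mat 1)"
    using assms by (auto simp: resolvent_simps)
  have *: "y \<in> resolvent \<and> stable_rank y = stable_rank x" if "y \<in> {ereal g<..}" for y
    using that PInf g dich_id_mono[OF g] dim_stable_id[OF dich_id_mono[OF g]]
    by (cases y) (auto simp: resolvent_simps stable_rank_simps intro!: exI[of _ "\<lambda>_. mat 1"])
  show ?thesis
    by (intro exI[of _ "{ereal g<..}"] conjI ballI * open_greaterThan) (simp_all add: PInf)
next
  case MInf
  then obtain g where g: "dich g (\<lambda>_. 0)"
    using assms by (auto simp: resolvent_simps)
  have *: "y \<in> resolvent \<and> stable_rank y = stable_rank x" if "y \<in> {..<ereal g}" for y
    using that MInf g dich_zero_antimono[OF g] dim_stable_zero[OF dich_zero_antimono[OF g]]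
    by (cases y) (auto simp: resolvent_simps stable_rank_simps intro!: exI[of _ "\<lambda>_. 0"])
  show ?thesis
    by (intro exI[of _ "{..<ereal g}"] conjI ballI * open_lessThan) (simp_all add: MInf)
qed

text \<open>Equal ranks mean equal stable spaces and hence one projector for both end points, which
  then works in between. Infinite end points are first replaced by real ones of the same rank, on
  the same side of \<open>\<eta>\<close>.\<close>

lemma resolvent_between:
  assumes "x \<in> resolvent" "y \<in> resolvent" "stable_rank x = stable_rank y" "x \<le> z" "z \<le> y"
  shows "z \<in> resolvent"
proof (cases z)
  case (real \<eta>)
  have 1: "\<exists>g \<le> \<eta>. (\<exists>P. dich g P) \<and> dim (stable g) = stable_rank x"
  proof (cases x)
    case (real g)
    then show ?thesis
      using assms \<open>z = ereal \<eta>\<close> by (auto simp: resolvent_simps stable_rank_simps)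
  next
    case MInf
    then obtain g where "dich g (\<lambda>_. 0)"
      using assms by (auto simp: resolvent_simps)
    then have "dich (min g \<eta>) (\<lambda>_. 0)"
      by (rule dich_zero_antimono) simp
    then show ?thesis
      using MInf dim_stable_zero by (intro exI[of _ "min g \<eta>"]) (auto simp: stable_rank_simps)
  qed (use assms real in auto)
  have 2: "\<exists>g \<ge> \<eta>. (\<exists>P. dich g P) \<and> dim (stable g) = stable_rank y"
  proof (cases y)
    case (real g)
    then show ?thesis
      using assms \<open>z = ereal \<eta>\<close> by (auto simp: resolvent_simps stable_rank_simps)
  next
    case PInf
    then obtain g where "dich g (\<lambda>_. mat 1)"
      using assms by (auto simp: resolvent_simps)
    then have "dich (max g \<eta>) (\<lambda>_. mat 1)"
      by (rule dich_id_mono) simp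
    then show ?thesis
      using PInf dim_stable_id by (intro exI[of _ "max g \<eta>"]) (auto simp: stable_rank_simps)
  qed (use assms real in auto)
  obtain g P where g: "g \<le> \<eta>" "dich g P" "dim (stable g) = stable_rank x"
    using 1 by blast
  obtain g' P' where g': "\<eta> \<le> g'" "dich g' P'" "dim (stable g') = stable_rank y"
    using 2 by blast
  have "g \<le> g'" using g g' by simp
  then have "P = P'"
    using g g' assms(3) by (intro dich_projector_unique[of g P g' P'] stable_eq_if_dim_eq) auto
  then have "dich \<eta> P"
    using dich_between[of g P g' \<eta>] g g' by simp
  then show ?thesis
    using real by (auto simp: resolvent_simps)
next
  case PInf
  then show ?thesis using assms by auto
next
  case MInf
  then show ?thesis using assms by auto
qed

end

section \<open>Complements of open sets with a locally constant rank\<close>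

text \<open>Induction on \<open>N\<close>: the new interval is either appended, or equal to the last
  one and dropped. Carrying \<open>a' m = a N\<close> and \<open>b' m = b N\<close> along gives
  access to that last interval.\<close>

lemma merge_repeated_intervals:
  fixes a b :: "nat \<Rightarrow> 'a::linorder"
  assumes "1 \<le> N" and "\<And>j. j \<in> {1..N} \<Longrightarrow> a j \<le> b j"
    and "\<And>j. 1 \<le> j \<Longrightarrow> j < N \<Longrightarrow> b j < a (Suc j) \<or> a (Suc j) = a j \<and> b (Suc j) = b j"
  shows "\<exists>m\<in>{1..N}. \<exists>a' b'. (\<forall>i\<in>{1..m}. a' i \<le> b' i) \<and>
    (\<forall>i. 1 \<le> i \<and> i < m \<longrightarrow> b' i < a' (Suc i)) \<and> a' m = a N \<and> b' m = b N \<and>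
    (\<Union>j\<in>{1..N}. {a j..b j}) = (\<Union>i\<in>{1..m}. {a' i..b' i})"
  using assms
proof (induction N rule: nat_induct_at_least)
  case base
  then show ?case by (intro bexI[of _ 1] exI[of _ a] exI[of _ b]) auto
next
  case (Suc N)
  then obtain m a' b' where m: "m \<in> {1..N}" "\<forall>i\<in>{1..m}. a' i \<le> b' i"
    "\<forall>i. 1 \<le> i \<and> i < m \<longrightarrow> b' i < a' (Suc i)" "a' m = a N" "b' m = b N"
    "(\<Union>j\<in>{1..N}. {a j..b j}) = (\<Union>i\<in>{1..m}. {a' i..b' i})"
    by force
  have U: "(\<Union>j\<in>{1..Suc N}. {a j..b j}) = (\<Union>j\<in>{1..N}. {a j..b j}) \<union> {a (Suc N)..b (Suc N)}"
    by (auto simp: atLeastAtMostSuc_conv)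
  consider "b N < a (Suc N)" | "a (Suc N) = a N" "b (Suc N) = b N"
    using Suc.prems(2)[of N] Suc.hyps by auto
  then show ?case
  proof cases
    case 1
    define a'' b'' where "a'' = a'(Suc m := a (Suc N))" and "b'' = b'(Suc m := b (Suc N))"
    have "(\<Union>i\<in>{1..Suc m}. {a'' i..b'' i}) = (\<Union>i\<in>{1..m}. {a' i..b' i}) \<union> {a (Suc N)..b (Suc N)}"
      unfolding a''_def b''_def by (auto simp: atLeastAtMostSuc_conv)
    moreover have "\<forall>i\<in>{1..Suc m}. a'' i \<le> b'' i"
      using m(2) Suc.prems(1)[of "Suc N"] by (auto simp: a''_def b''_def)
    moreover have "\<forall>i. 1 \<le> i \<and> i < Suc m \<longrightarrow> b'' i < a'' (Suc i)"
      using m 1 by (auto simp: a''_def b''_def less_Suc_eq)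
    ultimately show ?thesis
      using m(1) unfolding U m(6)
      by (intro bexI[of _ "Suc m"] exI[of _ a''] exI[of _ b'']) (auto simp: a''_def b''_def)
  next
    case 2
    have "{a (Suc N)..b (Suc N)} \<subseteq> (\<Union>j\<in>{1..N}. {a j..b j})"
      using 2 Suc.hyps by auto
    then have eq: "(\<Union>j\<in>{1..Suc N}. {a j..b j}) = (\<Union>i\<in>{1..m}. {a' i..b' i})"
      unfolding U m(6) by blast
    show ?thesis
      by (intro bexI[of _ m] exI[of _ a'] exI[of _ b'] conjI m(2,3) eq)
        (use m(1) in \<open>simp_all add: m(4,5) 2\<close>)
  qed
qed

text \<open>The \<open>j\<close>-th candidate interval is the gap between the points of rank less than \<open>j\<close>
  and those of rank at least \<open>j\<close>; gaps for neighbouring \<open>j\<close> coincide when rank \<open>j\<close> is not attained.\<close>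

lemma complement_eq_Union_intervals:
  fixes R :: "'a::{complete_linorder, dense_linorder, linorder_topology} set" and r :: "'a \<Rightarrow> nat"
  assumes "1 \<le> N"
    and le: "\<And>x. r x \<le> N"
    and mono: "\<And>x y. x \<le> y \<Longrightarrow> r x \<le> r y"
    and between: "\<And>x y z. x \<in> R \<Longrightarrow> y \<in> R \<Longrightarrow> r x = r y \<Longrightarrow> x \<le> z \<Longrightarrow> z \<le> y \<Longrightarrow> z \<in> R"
    and nhd: "\<And>x. x \<in> R \<Longrightarrow> \<exists>V. open V \<and> x \<in> V \<and> (\<forall>y\<in>V. y \<in> R \<and> r y = r x)"
    and top: "\<And>x. x \<in> R \<Longrightarrow> r x = N \<Longrightarrow> top \<in> R" and bot: "\<And>x. x \<in> R \<Longrightarrow> r x = 0 \<Longrightarrow> bot \<in> R"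
    and r_top: "r top = N" and r_bot: "r bot = 0"
  shows "\<exists>m\<in>{1..N}. \<exists>a b. (\<forall>i\<in>{1..m}. a i \<le> b i) \<and>
    (\<forall>i. 1 \<le> i \<and> i < m \<longrightarrow> b i < a (Suc i)) \<and> - R = (\<Union>i\<in>{1..m}. {a i..b i})"
proof -
  \<comment> \<open>The supremum of the empty set is \<open>bot\<close> and its infimum
    \<open>top\<close>, so a gap may reach an end of the line.\<close>
  define a where "a = (\<lambda>j. Sup {x \<in> R. r x < j})"
  define b where "b = (\<lambda>j. Inf {x \<in> R. j \<le> r x})"
  have ab: "a j \<le> b j" for j
    unfolding a_def b_def
  proof (intro Sup_least Inf_greatest; elim CollectE conjE)
    show "x \<le> y" if "r x < j" "j \<le> r y" for x y
      using mono[of y x] that by (meson leD le_less_trans linear)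
  qed
  \<comment> \<open>\<open>R\<close> extends a little to the right of \<open>x\<close> with the same
    rank, so \<open>x\<close> lies strictly below the supremum. There is room on the right because
    \<open>x\<close> has rank below \<open>N\<close> while \<open>top\<close> has rank
    \<open>N\<close>.\<close>
  have lt_a: "x < a j" if "x \<in> R" "r x < j" "j \<le> N" for x j
  proof -
    have "x \<noteq> top" using that r_top by auto
    then have "x < top" by (simp add: top.not_eq_extremum)
    obtain V where V: "open V" "x \<in> V" "\<forall>y\<in>V. y \<in> R \<and> r y = r x"
      using nhd \<open>x \<in> R\<close> by blast
    obtain u where u: "x < u" "{x..<u} \<subseteq> V"
      using open_right[OF V(1,2) \<open>x < top\<close>] by blast
    obtain y where y: "x < y" "y < u"
      using dense[OF u(1)] by blast
    then have "y \<in> V" using u(2) by auto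
    then have "y \<in> {x \<in> R. r x < j}"
      using V(3) that(2) by simp
    then have "y \<le> a j" unfolding a_def by (rule Sup_upper)
    with y(1) show ?thesis by simp
  qed
  have gt_b: "b j < x" if "x \<in> R" "j \<le> r x" "1 \<le> j" for x j
  proof -
    have "x \<noteq> bot" using that r_bot by auto
    then have "bot < x" by (simp add: bot.not_eq_extremum)
    obtain V where V: "open V" "x \<in> V" "\<forall>y\<in>V. y \<in> R \<and> r y = r x"
      using nhd \<open>x \<in> R\<close> by blast
    obtain u where u: "u < x" "{u<..x} \<subseteq> V"
      using open_left[OF V(1,2) \<open>bot < x\<close>] by blast
    obtain y where y: "u < y" "y < x"
      using dense[OF u(1)] by blast
    then have "y \<in> V" using u(2) by auto
    then have "y \<in> {x \<in> R. j \<le> r x}"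
      using V(3) that(2) by simp
    then have "b j \<le> y" unfolding b_def by (rule Inf_lower)
    with y(2) show ?thesis by simp
  qed
  have cover: "\<exists>j\<in>{1..N}. x \<in> {a j..b j}" if "x \<notin> R" for x
  proof -
    \<comment> \<open>The largest rank attained in \<open>R\<close> strictly below \<open>x\<close>,
      and 0 if there is no such point. The gap containing \<open>x\<close> will be the one with
      index \<open>Suc k\<close>.\<close>
    define k where "k = (LEAST k. \<forall>y\<in>R. y < x \<longrightarrow> r y \<le> k)"
    have k: "r y \<le> k" if "y \<in> R" "y < x" for y
      using LeastI[of "\<lambda>k. \<forall>y\<in>R. y < x \<longrightarrow> r y \<le> k" N] le that unfolding k_def by blast
    have attained: "\<exists>y\<in>R. y < x \<and> r y = k" if "0 < k"
    proof -
      have "\<not> (\<forall>y\<in>R. y < x \<longrightarrow> r y \<le> k - 1)"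
        using not_less_Least[of "k - 1" "\<lambda>k. \<forall>y\<in>R. y < x \<longrightarrow> r y \<le> k"] that
        unfolding k_def[symmetric] by simp
      then obtain y where "y \<in> R" "y < x" "\<not> r y \<le> k - 1" by blast
      moreover from this have "r y \<le> k" using k by blast
      ultimately show ?thesis by (intro bexI[of _ y]) auto
    qed
    \<comment> \<open>A point of rank \<open>k\<close> at or above \<open>x\<close> together with
      one at or below it would put \<open>x\<close> into \<open>R\<close>. For \<open>k = 0\<close>
      there may be no point of \<open>R\<close> below \<open>x\<close>; then \<open>bot\<close>
      serves as the lower one.\<close>
    have no_k_above: "r y \<noteq> k" if "y \<in> R" "x \<le> y" for y
    proof
      assume "r y = k"
      have "\<exists>z\<in>R. z \<le> x \<and> r z = k"
      proof (cases "k = 0")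
        case True
        then have "bot \<in> R" using bot \<open>y \<in> R\<close> \<open>r y = k\<close> by auto
        then show ?thesis using True r_bot by (intro bexI[of _ bot]) auto
      next
        case False
        then show ?thesis using attained by (auto intro: less_imp_le)
      qed
      then obtain z where "z \<in> R" "z \<le> x" "r z = k" by blast
      then have "x \<in> R"
        using between[of z y x] that \<open>r y = k\<close> by simp
      then show False using \<open>x \<notin> R\<close> by simp
    qed
    \<comment> \<open>Rank \<open>N\<close> attained below \<open>x\<close> would put
      \<open>top\<close> into \<open>R\<close>, giving a point of rank \<open>k\<close> above
      \<open>x\<close>.\<close>
    have "k < N"
    proof (rule ccontr)
      assume "\<not> k < N"
      then have "0 < k" using \<open>1 \<le> N\<close> by simp
      then obtain y where y: "y \<in> R" "r y = k" using attained by blast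
      then have "k = N" using le[of y] \<open>\<not> k < N\<close> by simp
      then have "top \<in> R" using top y by blast
      then show False using no_k_above[of top] r_top \<open>k = N\<close> by simp
    qed
    moreover have "a (Suc k) \<le> x"
      unfolding a_def
    proof (rule Sup_least, elim CollectE conjE, rule ccontr)
      fix y assume y: "y \<in> R" "r y < Suc k" "\<not> y \<le> x"
      then have "x \<le> y" by simp
      then have "r y < k" using no_k_above[OF y(1)] y(2) by simp
      then obtain z where "z < x" "r z = k" using attained by auto
      then have "k \<le> r y" using mono[of z y] \<open>x \<le> y\<close> by simp
      then show False using \<open>r y < k\<close> by simp
    qed
    moreover have "x \<le> b (Suc k)"
      unfolding b_def
    proof (rule Inf_greatest, elim CollectE conjE, rule ccontr)
      fix y assume y: "y \<in> R" "Suc k \<le> r y" "\<not> x \<le> y"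
      then have "y < x" by simp
      then show False using k[OF y(1)] y(2) by simp
    qed
    ultimately show ?thesis by (intro bexI[of _ "Suc k"]) auto
  qed
  have "- R = (\<Union>j\<in>{1..N}. {a j..b j})"
  proof (intro equalityI subsetI)
    show "x \<in> (\<Union>j\<in>{1..N}. {a j..b j})" if "x \<in> - R" for x
      using cover[of x] that by simp
    fix x assume "x \<in> (\<Union>j\<in>{1..N}. {a j..b j})"
    then obtain j where j: "1 \<le> j" "j \<le> N" "a j \<le> x" "x \<le> b j" by auto
    show "x \<in> - R"
    proof
      assume "x \<in> R"
      then show False
        using lt_a[of x j] gt_b[of x j] j by (cases "r x < j") auto
    qed
  qed
  moreover have "b j < a (Suc j) \<or> a (Suc j) = a j \<and> b (Suc j) = b j" if j: "1 \<le> j" "j < N" for j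
  proof (cases "\<exists>y\<in>R. r y = j")
    case True
    then obtain y where "y \<in> R" "r y = j" by blast
    then have "b j < y" "y < a (Suc j)"
      using gt_b[of y j] lt_a[of y "Suc j"] j by auto
    then have "b j < a (Suc j)" by (rule less_trans)
    then show ?thesis by simp
  next
    case False
    then have "{x \<in> R. r x < Suc j} = {x \<in> R. r x < j}" "{x \<in> R. Suc j \<le> r x} = {x \<in> R. j \<le> r x}"
      by (auto simp: less_Suc_eq Suc_le_eq order.order_iff_strict)
    then show ?thesis by (simp add: a_def b_def)
  qed
  ultimately show ?thesis
    using merge_repeated_intervals[of N a b] \<open>1 \<le> N\<close> ab by auto
qed

section \<open>The spectral theorem\<close>

lemma rate_cocycle_evolution:
  assumes A: "locally_integrable A" and \<mu>: "growth_rate \<mu>"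
  shows "rate_cocycle (\<lambda>t. ln (\<mu> t)) (evolution_operator A)"
proof
  have pos: "\<mu> t > 0" for t
    using \<mu> by (simp add: growth_rate_def)
  show "mono (\<lambda>t. ln (\<mu> t))"
    using \<mu> pos by (auto simp: growth_rate_def strict_mono_less_eq intro!: monoI)
  show "ln (\<mu> 0) = 0"
    using \<mu> by (simp add: growth_rate_def)
  show "filterlim (\<lambda>t. ln (\<mu> t)) at_top at_top"
    using \<mu> by (intro filterlim_compose[OF ln_at_top]) (simp add: growth_rate_def)
  have "filterlim \<mu> (at_right 0) at_bot"
    using \<mu> by (intro tendsto_imp_filterlim_at_right) (auto simp: growth_rate_def)
  then show "filterlim (\<lambda>t. ln (\<mu> t)) at_bot at_bot"
    by (rule filterlim_compose[OF ln_at_0])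
qed (simp_all add: evolution_operator_refl evolution_operator_cocycle A)

text \<open>Multiplying the estimates by \<open>exp (\<gamma> * (h t - h s))\<close> moves the shift
  from the cocycle into the exponents.\<close>

lemma nmu_dichotomy_shifted_iff:
  fixes A :: "real \<Rightarrow> real^'n^'n"
  assumes A: "locally_integrable A" and \<mu>: "growth_rate \<mu>"
  shows "nmu_dichotomy \<mu> (shifted \<mu> A \<gamma>) P
    \<longleftrightarrow> rate_cocycle.dich (\<lambda>t. ln (\<mu> t)) (evolution_operator A) \<gamma> P"
proof -
  define h where "h = (\<lambda>t. ln (\<mu> t))"
  let ?E = "evolution_operator A"
  interpret rate_cocycle h ?E
    unfolding h_def by (rule rate_cocycle_evolution[OF A \<mu>])
  have inv: "invariant_projector (shifted \<mu> A \<gamma>) P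
      \<longleftrightarrow> (\<forall>s. P s ** P s = P s) \<and> (\<forall>t s. P t ** ?E t s = ?E t s ** P s)"
    by (simp add: invariant_projector_def evolution_operator_shifted[OF A \<mu>] matrix_mult_scaleR)
  have est: "mat_norm (evolution_operator (shifted \<mu> A \<gamma>) t s ** M)
        \<le> K * (\<mu> t / \<mu> s) powr \<alpha> * \<mu> s powr (sgn s * \<theta>)
      \<longleftrightarrow> mat_norm (?E t s ** M) \<le> K * exp ((\<alpha> + \<gamma>) * (h t - h s) + \<theta> * \<bar>h s\<bar>)"
    for t s K \<alpha> \<theta> and M :: "real^'n^'n"
  proof -
    have "mat_norm (evolution_operator (shifted \<mu> A \<gamma>) t s ** M)
        = exp (- \<gamma> * (h t - h s)) * mat_norm (?E t s ** M)"
      by (simp add: evolution_operator_shifted[OF A \<mu>] matrix_mult_scaleR mat_norm_scaleR h_def)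
    moreover have "K * (\<mu> t / \<mu> s) powr \<alpha> * \<mu> s powr (sgn s * \<theta>)
        = exp (- \<gamma> * (h t - h s)) * (K * exp ((\<alpha> + \<gamma>) * (h t - h s) + \<theta> * \<bar>h s\<bar>))"
    proof -
      have "exp (\<alpha> * (h t - h s)) * exp (\<theta> * \<bar>h s\<bar>)
          = exp (- \<gamma> * (h t - h s)) * exp ((\<alpha> + \<gamma>) * (h t - h s) + \<theta> * \<bar>h s\<bar>)"
        unfolding exp_add[symmetric] by (simp add: algebra_simps)
      then show ?thesis
        unfolding growth_rate_powr[OF \<mu>] by (simp add: h_def)
    qed
    ultimately show ?thesis
      by (simp only: mult_le_cancel_left_pos[OF exp_gt_zero])
  qed
  have "nmu_dichotomy \<mu> (shifted \<mu> A \<gamma>) P \<longleftrightarrow> dich \<gamma> P"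
  proof
    assume "nmu_dichotomy \<mu> (shifted \<mu> A \<gamma>) P"
    then obtain K \<alpha> \<beta> \<theta> \<nu> where P: "invariant_projector (shifted \<mu> A \<gamma>) P"
      and K: "1 \<le> K" "0 \<le> \<theta>" "0 \<le> \<nu>" "\<alpha> + \<theta> < 0" "\<beta> - \<nu> > 0"
      and f: "\<And>t s. s \<le> t \<Longrightarrow> mat_norm (?E t s ** P s)
          \<le> K * exp ((\<alpha> + \<gamma>) * (h t - h s) + \<theta> * \<bar>h s\<bar>)"
      and b: "\<And>t s. t \<le> s \<Longrightarrow> mat_norm (?E t s ** (mat 1 - P s))
          \<le> K * exp ((\<beta> + \<gamma>) * (h t - h s) + \<nu> * \<bar>h s\<bar>)"
      unfolding nmu_dichotomy_def est by blast
    show "dich \<gamma> P"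
      by (rule dichI[OF _ _ _ _ _ _ _ _ f b]) (use P K in \<open>simp_all add: inv\<close>)
  next
    assume d: "dich \<gamma> P"
    obtain K a b \<theta> \<nu> where K: "1 \<le> K" "0 \<le> \<theta>" "0 \<le> \<nu>" "a + \<theta> < \<gamma>" "\<gamma> < b - \<nu>"
      and f: "\<And>t s. s \<le> t \<Longrightarrow> mat_norm (?E t s ** P s) \<le> K * exp (a * (h t - h s) + \<theta> * \<bar>h s\<bar>)"
      and b: "\<And>t s. t \<le> s \<Longrightarrow> mat_norm (?E t s ** (mat 1 - P s)) \<le> K * exp (b * (h t - h s) + \<nu> * \<bar>h s\<bar>)"
      using d by (rule dichE) metis
    have "invariant_projector (shifted \<mu> A \<gamma>) P"
      unfolding inv using dich_projection[OF d] dich_invariant[OF d] by blast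
    \<comment> \<open>The signs \<open>a - \<gamma> < 0 < b - \<gamma>\<close> come from the strict
      inequalities for \<open>a + \<theta>\<close> and \<open>b - \<nu>\<close>, as
      \<open>\<theta>\<close> and \<open>\<nu>\<close> are nonnegative.\<close>
    then show "nmu_dichotomy \<mu> (shifted \<mu> A \<gamma>) P"
      unfolding nmu_dichotomy_def est
      by (intro conjI exI[of _ K] exI[of _ "a - \<gamma>"] exI[of _ "b - \<gamma>"] exI[of _ \<theta>] exI[of _ \<nu>]
          allI impI) (use K f b in simp_all)
  qed
  then show ?thesis by (simp add: h_def)
qed

text \<open>As for dichotomies: \<open>\<tau> = 0\<close> in one direction, and in the other a
  change of base point paid for by a factor continuous in \<open>\<tau>\<close>.\<close>

lemma nmu_bounded_growth_family_iff:
  fixes A :: "real \<Rightarrow> real^'n^'n"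
  assumes A: "locally_integrable A" and \<mu>: "growth_rate \<mu>"
  shows "nmu_bounded_growth_family \<mu> A
    \<longleftrightarrow> rate_cocycle.bounded_growth (\<lambda>t. ln (\<mu> t)) (evolution_operator A)"
proof -
  define h where "h = (\<lambda>t. ln (\<mu> t))"
  let ?E = "evolution_operator A"
  interpret rate_cocycle h ?E
    unfolding h_def by (rule rate_cocycle_evolution[OF A \<mu>])
  have sgn: "sgn (t - s) * a * (h (t + \<tau>) - h (s + \<tau>)) = a * \<bar>h (t + \<tau>) - h (s + \<tau>)\<bar>" for a t s \<tau>
    using h_le[of "s + \<tau>" "t + \<tau>"] h_le[of "t + \<tau>" "s + \<tau>"]
    by (cases t s rule: linorder_cases) (auto simp: algebra_simps)
  have est: "L * (translate_rate \<mu> \<tau> t / translate_rate \<mu> \<tau> s) powr (sgn (t - s) * a)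
        * translate_rate \<mu> \<tau> s powr (sgn s * \<epsilon>)
      = L * exp (a * \<bar>h (t + \<tau>) - h (s + \<tau>)\<bar>) * exp (\<epsilon> * \<bar>h (s + \<tau>) - h \<tau>\<bar>)" for L \<tau> t s a \<epsilon>
    unfolding translate_rate_powr[OF \<mu>] sgn[symmetric]
    by (simp add: h_def)
  have "nmu_bounded_growth_family \<mu> A \<longleftrightarrow> bounded_growth"
  proof
    assume "nmu_bounded_growth_family \<mu> A"
    then obtain L a \<epsilon> where L: "\<forall>\<tau>. L \<tau> \<ge> 1" "a > 0" "\<epsilon> \<ge> 0"
      and g: "\<And>\<tau> t s. mat_norm (translated_evolution A \<tau> t s)
        \<le> L \<tau> * exp (a * \<bar>h (t + \<tau>) - h (s + \<tau>)\<bar>) * exp (\<epsilon> * \<bar>h (s + \<tau>) - h \<tau>\<bar>)"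
      unfolding nmu_bounded_growth_family_def est by blast
    have "mat_norm (?E t s) \<le> L 0 * exp (a * \<bar>h t - h s\<bar> + \<epsilon> * \<bar>h s\<bar>)" for t s
      using g[of 0 t s] by (simp add: translated_evolution_def h_zero exp_add mult.assoc)
    then show bounded_growth
      unfolding bounded_growth_def using L
      by (intro exI[of _ "L 0"] exI[of _ a] exI[of _ \<epsilon>]) auto
  next
    assume bounded_growth
    then obtain L a \<epsilon> where L: "1 \<le> L" "0 < a" "0 \<le> \<epsilon>"
      and g: "\<And>t s. mat_norm (?E t s) \<le> L * exp (a * \<bar>h t - h s\<bar> + \<epsilon> * \<bar>h s\<bar>)"
      unfolding bounded_growth_def by blast
    define K where "K = (\<lambda>\<tau>. L * exp (\<epsilon> * \<bar>h \<tau>\<bar>))"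
    have "continuous_on UNIV K"
      unfolding K_def h_def
      by (intro continuous_on_mult_left continuous_on_exp continuous_on_rabs
          continuous_on_ln_growth_rate[OF \<mu>])
    moreover have "1 * 1 \<le> K \<tau>" for \<tau>
      unfolding K_def using L by (intro mult_mono) auto
    moreover have "mat_norm (translated_evolution A \<tau> t s)
        \<le> K \<tau> * exp (a * \<bar>h (t + \<tau>) - h (s + \<tau>)\<bar>) * exp (\<epsilon> * \<bar>h (s + \<tau>) - h \<tau>\<bar>)" for \<tau> t s
      unfolding K_def translated_evolution_def
      by (rule order_trans[OF g, unfolded exp_add mult.assoc[symmetric], OF exp_abs_shift_le])
        (use L in auto)
    ultimately show "nmu_bounded_growth_family \<mu> A"
      unfolding nmu_bounded_growth_family_def est using L
      by (intro exI[of _ K] exI[of _ a] exI[of _ \<epsilon>]) simp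
  qed
  then show ?thesis by (simp add: h_def)
qed

theorem theorem2p17:
  fixes A :: "real \<Rightarrow> real^'n^'n" and \<mu> :: "real \<Rightarrow> real"
  assumes "locally_integrable A" and "growth_rate \<mu>"
  shows "(\<exists>m\<in>{1..CARD('n)}. \<exists>a b :: nat \<Rightarrow> ereal.
            (\<forall>i\<in>{1..m}. a i \<le> b i) \<and> (\<forall>i. 1 \<le> i \<and> i < m \<longrightarrow> b i < a (i + 1)) \<and>
            nmu_spectrum \<mu> A = nmu_spectrum_family \<mu> A \<and>
            nmu_spectrum_family \<mu> A = (\<Union>i\<in>{1..m}. {a i..b i})) \<and>
         (nmu_bounded_growth_family \<mu> A \<longleftrightarrow> bounded_subset_of_reals (nmu_spectrum_family \<mu> A))"
proof -
  interpret C: rate_cocycle "\<lambda>t. ln (\<mu> t)" "evolution_operator A"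
    by (rule rate_cocycle_evolution[OF assms])
  have spectrum: "nmu_spectrum \<mu> A = - C.resolvent"
    by (auto simp: nmu_spectrum_def shifted_has_dichotomy_def C.resolvent_def
        nmu_dichotomy_shifted_iff[OF assms] cong: ereal.case_cong)
  have family: "nmu_spectrum_family \<mu> A = nmu_spectrum \<mu> A"
    by (rule nmu_spectrum_family_eq[OF assms(2)])
  have "\<exists>m\<in>{1..CARD('n)}. \<exists>a b :: nat \<Rightarrow> ereal. (\<forall>i\<in>{1..m}. a i \<le> b i) \<and>
      (\<forall>i. 1 \<le> i \<and> i < m \<longrightarrow> b i < a (Suc i)) \<and> - C.resolvent = (\<Union>i\<in>{1..m}. {a i..b i})"
  proof (rule complement_eq_Union_intervals[where r = C.stable_rank])
    show "1 \<le> CARD('n)" by (simp add: Suc_leI)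
    show "top \<in> C.resolvent" if "x \<in> C.resolvent" "C.stable_rank x = CARD('n)" for x
      using C.infinity_in_resolvent[OF that] by (simp add: top_ereal_def)
    show "bot \<in> C.resolvent" if "x \<in> C.resolvent" "C.stable_rank x = 0" for x
      using C.minus_infinity_in_resolvent[OF that] by (simp add: bot_ereal_def)
    show "C.stable_rank top = CARD('n)" "C.stable_rank bot = 0"
      by (simp_all add: top_ereal_def bot_ereal_def C.stable_rank_simps)
  qed (fact C.stable_rank_le C.stable_rank_mono C.resolvent_between C.resolvent_open)+
  moreover have "bounded_subset_of_reals (- C.resolvent) \<longleftrightarrow> nmu_bounded_growth_family \<mu> A"
    unfolding nmu_bounded_growth_family_iff[OF assms] C.bounded_growth_iff C.resolvent_simps(2,3)[symmetric]
  proof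
    assume "bounded_subset_of_reals (- C.resolvent)"
    then obtain T where "- C.resolvent = ereal ` T"
      by (auto simp: bounded_subset_of_reals_def)
    \<comment> \<open>No value of \<open>ereal\<close> is infinite, so a spectrum consisting of
      reals leaves both infinities to the resolvent set.\<close>
    then have "\<infinity> \<notin> - C.resolvent" "- \<infinity> \<notin> - C.resolvent" by auto
    then show "\<infinity> \<in> C.resolvent \<and> - \<infinity> \<in> C.resolvent" by simp
  next
    assume inf: "\<infinity> \<in> C.resolvent \<and> - \<infinity> \<in> C.resolvent"
    then obtain u l where u: "C.dich u (\<lambda>_. mat 1)" and l: "C.dich l (\<lambda>_. 0)"
      unfolding C.resolvent_simps by blast
    define T where "T = {g. ereal g \<notin> C.resolvent}"
    \<comment> \<open>Above \<open>u\<close> the identity projector works and below \<open>l\<close>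
      the zero projector, so the spectrum is confined to the interval between.\<close>
    have "T \<subseteq> {l..u}"
    proof
      fix g assume "g \<in> T"
      then have "\<not> C.dich g P" for P
        unfolding T_def C.resolvent_simps by blast
      then show "g \<in> {l..u}"
        using C.dich_id_mono[OF u, of g] C.dich_zero_antimono[OF l, of g] by force
    qed
    then have "bounded T"
      using bounded_closed_interval bounded_subset by blast
    moreover have "- C.resolvent = ereal ` T"
    proof (intro equalityI subsetI)
      show "x \<in> ereal ` T" if "x \<in> - C.resolvent" for x
        using that inf by (cases x) (auto simp: T_def)
    qed (auto simp: T_def)
    ultimately show "bounded_subset_of_reals (- C.resolvent)"
      unfolding bounded_subset_of_reals_def by blast
  qed
  ultimately show ?thesis
    unfolding family spectrum by simp
qed

end
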